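(* Let $G$ be a polycyclic-by-finite group and let $\mathbf{k}$ be a left-noetherian ring. Then $\mathrm{Rep}_{\mathbf{k}}(\mathbf{FI}_G)$ is noetherian.
   Context: A group $G$ is polycyclic if it has a finite composition series $1=G_0\subseteq G_1\subseteq\cdots\subseteq G_r=G$ (each $G_{i-1}$ normal in $G_i$) with all $G_i/G_{i-1}$ cyclic; it is polycyclic-by-finite if it contains a polycyclic subgroup of finite index. Rings are nonzero and not necessarily commutative. A $G$-map $R \to S$ between finite sets is a pair $(f,\rho)$ of functions $f\colon R \to S$ and $\rho\colon R \to G$. The composition of $(f,\rho)\colon R\to S$ followed by $(g,\sigma)\colon S\to T$ is $(g\circ f,\tau)$ with $\tau(x)=\sigma(f(x))\rho(x)$. The category $\mathbf{FI}_G$ has finite sets as objects and as morphisms the $G$-maps $(f,\rho)$ with $f$ injective. For an essentially small category $\mathcal{C}$ and a ring $\mathbf{k}$, $\mathrm{Rep}_{\mathbf{k}}(\mathcal{C})$ is the abelian category of functors from $\mathcal{C}$ to left $\mathbf{k}$-modules. For an object $x$, the principal projective $P_x$ is $P_x(y)=\mathbf{k}[\mathrm{Hom}(x,y)]$, the free left $\mathbf{k}$-module on $\mathrm{Hom}(x,y)$. A representation is finitely generated if it is a quotient of a finite direct sum of principal projectives, and noetherian if every ascending chain of subrepresentations stabilizes. $\mathrm{Rep}_{\mathbf{k}}(\mathcal{C})$ is noetherian if every finitely generated object in it is noetherian. *)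

theory Defs
  imports "HOL-Algebra.Algebra" "HOL-Library.Infinite_Typeclass"
begin

section \<open>Groups\<close>

definition polycyclic :: "('g, 'b) monoid_scheme \<Rightarrow> bool" where
  "polycyclic G \<longleftrightarrow> group G \<and>
     (\<exists>(r::nat) H. H 0 = {\<one>\<^bsub>G\<^esub>} \<and> H r = carrier G \<and>
        (\<forall>i\<le>r. subgroup (H i) G) \<and>
        (\<forall>i<r. H i \<subseteq> H (Suc i) \<and> H i \<lhd> (G\<lparr>carrier := H (Suc i)\<rparr>) \<and>
           cyclic_group ((G\<lparr>carrier := H (Suc i)\<rparr>) Mod (H i))))"

definition polycyclic_by_finite :: "('g, 'b) monoid_scheme \<Rightarrow> bool" where
  "polycyclic_by_finite G \<longleftrightarrow> group G \<and>
     (\<exists>H. subgroup H G \<and> finite (rcosets\<^bsub>G\<^esub> H) \<and> polycyclic (G\<lparr>carrier := H\<rparr>))"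

section \<open>Left modules\<close>

definition left_ideal :: "'r set \<Rightarrow> ('r, 'b) ring_scheme \<Rightarrow> bool" where
  "left_ideal I R \<longleftrightarrow> subgroup I (add_monoid R) \<and>
     (\<forall>a \<in> carrier R. \<forall>x \<in> I. a \<otimes>\<^bsub>R\<^esub> x \<in> I)"

text \<open>The library's \<open>noetherian_ring\<close> is about two-sided ideals.\<close>

definition left_noetherian :: "('r, 'b) ring_scheme \<Rightarrow> bool" where
  "left_noetherian R \<longleftrightarrow> ring R \<and>
     (\<forall>I :: nat \<Rightarrow> 'r set. (\<forall>n. left_ideal (I n) R) \<and> (\<forall>n. I n \<subseteq> I (Suc n)) \<longrightarrow>
        (\<exists>n0. \<forall>n\<ge>n0. I n = I n0))"

text \<open>As the library's \<open>module\<close>, but without commutativity of the ring. In the module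
  record only the fields \<open>carrier\<close>, \<open>add\<close>, \<open>zero\<close> and \<open>smult\<close> are relevant.\<close>

locale left_module = R?: ring R + M?: abelian_group M
  for R :: "('r, 'b) ring_scheme" (structure) and M :: "('r, 'v, 'c) module_scheme" (structure) +
  assumes smult_closed [simp, intro]:
      "\<lbrakk>a \<in> carrier R; x \<in> carrier M\<rbrakk> \<Longrightarrow> a \<odot>\<^bsub>M\<^esub> x \<in> carrier M"
    and smult_l_distr:
      "\<lbrakk>a \<in> carrier R; b \<in> carrier R; x \<in> carrier M\<rbrakk> \<Longrightarrow>
        (a \<oplus> b) \<odot>\<^bsub>M\<^esub> x = a \<odot>\<^bsub>M\<^esub> x \<oplus>\<^bsub>M\<^esub> b \<odot>\<^bsub>M\<^esub> x"
    and smult_r_distr: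
      "\<lbrakk>a \<in> carrier R; x \<in> carrier M; y \<in> carrier M\<rbrakk> \<Longrightarrow>
        a \<odot>\<^bsub>M\<^esub> (x \<oplus>\<^bsub>M\<^esub> y) = a \<odot>\<^bsub>M\<^esub> x \<oplus>\<^bsub>M\<^esub> a \<odot>\<^bsub>M\<^esub> y"
    and smult_assoc1:
      "\<lbrakk>a \<in> carrier R; b \<in> carrier R; x \<in> carrier M\<rbrakk> \<Longrightarrow>
        (a \<otimes> b) \<odot>\<^bsub>M\<^esub> x = a \<odot>\<^bsub>M\<^esub> (b \<odot>\<^bsub>M\<^esub> x)"
    and smult_one [simp]:
      "x \<in> carrier M \<Longrightarrow> \<one> \<odot>\<^bsub>M\<^esub> x = x"

definition left_module_hom ::
  "('r, 'b) ring_scheme \<Rightarrow> ('r, 'v) module \<Rightarrow> ('r, 'w) module \<Rightarrow> ('v \<Rightarrow> 'w) set" where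
  "left_module_hom R M N = {f. f \<in> carrier M \<rightarrow> carrier N \<and>
     (\<forall>x \<in> carrier M. \<forall>y \<in> carrier M. f (x \<oplus>\<^bsub>M\<^esub> y) = f x \<oplus>\<^bsub>N\<^esub> f y) \<and>
     (\<forall>a \<in> carrier R. \<forall>x \<in> carrier M. f (a \<odot>\<^bsub>M\<^esub> x) = a \<odot>\<^bsub>N\<^esub> f x)}"

text \<open>The free left module on a set \<open>B\<close> consists of the finitely supported functions on \<open>B\<close>,
  extended by zero to the whole type. The fields \<open>mult\<close> and \<open>one\<close> are irrelevant.\<close>

definition free_module :: "('r, 'b) ring_scheme \<Rightarrow> 'm set \<Rightarrow> ('r, 'm \<Rightarrow> 'r) module" where
  "free_module R B =
     \<lparr>carrier = {a. (\<forall>h. a h \<in> carrier R) \<and> finite {h. a h \<noteq> \<zero>\<^bsub>R\<^esub>} \<and> {h. a h \<noteq> \<zero>\<^bsub>R\<^esub>} \<subseteq> B},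
      monoid.mult = undefined, one = undefined,
      ring.zero = (\<lambda>h. \<zero>\<^bsub>R\<^esub>), ring.add = (\<lambda>a b h. a h \<oplus>\<^bsub>R\<^esub> b h),
      module.smult = (\<lambda>c a h. c \<otimes>\<^bsub>R\<^esub> a h)\<rparr>"

section \<open>Categories\<close>

text \<open>Hom-sets of different pairs of objects need not be disjoint; therefore composition takes
  the three objects as arguments. \<open>Comp C x y z g f\<close> is \<open>f : x \<rightarrow> y\<close> followed by \<open>g : y \<rightarrow> z\<close>.\<close>

record ('o, 'm) category =
  Obj :: "'o set"
  Hom :: "'o \<Rightarrow> 'o \<Rightarrow> 'm set"
  Comp :: "'o \<Rightarrow> 'o \<Rightarrow> 'o \<Rightarrow> 'm \<Rightarrow> 'm \<Rightarrow> 'm"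
  Ident :: "'o \<Rightarrow> 'm"

locale category =
  fixes C :: "('o, 'm) category"
  assumes Ident_in_Hom: "x \<in> Obj C \<Longrightarrow> Ident C x \<in> Hom C x x"
    and Comp_in_Hom:
      "\<lbrakk>x \<in> Obj C; y \<in> Obj C; z \<in> Obj C; f \<in> Hom C x y; g \<in> Hom C y z\<rbrakk> \<Longrightarrow>
        Comp C x y z g f \<in> Hom C x z"
    and Comp_Ident_left:
      "\<lbrakk>x \<in> Obj C; y \<in> Obj C; f \<in> Hom C x y\<rbrakk> \<Longrightarrow> Comp C x y y (Ident C y) f = f"
    and Comp_Ident_right:
      "\<lbrakk>x \<in> Obj C; y \<in> Obj C; f \<in> Hom C x y\<rbrakk> \<Longrightarrow> Comp C x x y f (Ident C x) = f"
    and Comp_assoc: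
      "\<lbrakk>w \<in> Obj C; x \<in> Obj C; y \<in> Obj C; z \<in> Obj C;
        f \<in> Hom C w x; g \<in> Hom C x y; h \<in> Hom C y z\<rbrakk> \<Longrightarrow>
        Comp C w y z h (Comp C w x y g f) = Comp C w x z (Comp C x y z h g) f"

section \<open>Representations of categories\<close>

record ('o, 'm, 'r, 'v) rep =
  Val :: "'o \<Rightarrow> ('r, 'v) module"
  Act :: "'o \<Rightarrow> 'o \<Rightarrow> 'm \<Rightarrow> 'v \<Rightarrow> 'v"

definition representation ::
  "('o, 'm) category \<Rightarrow> ('r, 'b) ring_scheme \<Rightarrow> ('o, 'm, 'r, 'v) rep \<Rightarrow> bool" where
  "representation C R M \<longleftrightarrow>
     (\<forall>x \<in> Obj C. left_module R (Val M x)) \<and>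
     (\<forall>x \<in> Obj C. \<forall>y \<in> Obj C. \<forall>f \<in> Hom C x y.
        Act M x y f \<in> left_module_hom R (Val M x) (Val M y)) \<and>
     (\<forall>x \<in> Obj C. \<forall>v \<in> carrier (Val M x). Act M x x (Ident C x) v = v) \<and>
     (\<forall>x \<in> Obj C. \<forall>y \<in> Obj C. \<forall>z \<in> Obj C. \<forall>f \<in> Hom C x y. \<forall>g \<in> Hom C y z.
        \<forall>v \<in> carrier (Val M x).
          Act M x z (Comp C x y z g f) v = Act M y z g (Act M x y f v))"

definition rep_hom ::
  "('o, 'm) category \<Rightarrow> ('r, 'b) ring_scheme \<Rightarrow> ('o, 'm, 'r, 'v) rep \<Rightarrow> ('o, 'm, 'r, 'w) rep
     \<Rightarrow> ('o \<Rightarrow> 'v \<Rightarrow> 'w) set" where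
  "rep_hom C R M N = {\<eta>.
     (\<forall>x \<in> Obj C. \<eta> x \<in> left_module_hom R (Val M x) (Val N x)) \<and>
     (\<forall>x \<in> Obj C. \<forall>y \<in> Obj C. \<forall>f \<in> Hom C x y. \<forall>v \<in> carrier (Val M x).
        \<eta> y (Act M x y f v) = Act N x y f (\<eta> x v))}"

definition rep_quotient ::
  "('o, 'm) category \<Rightarrow> ('r, 'b) ring_scheme \<Rightarrow> ('o, 'm, 'r, 'v) rep \<Rightarrow> ('o, 'm, 'r, 'w) rep
     \<Rightarrow> bool" where
  "rep_quotient C R M N \<longleftrightarrow>
     (\<exists>\<eta> \<in> rep_hom C R M N. \<forall>x \<in> Obj C. \<eta> x ` carrier (Val M x) = carrier (Val N x))"

definition subrepresentation ::
  "('o, 'm) category \<Rightarrow> ('r, 'b) ring_scheme \<Rightarrow> ('o \<Rightarrow> 'v set) \<Rightarrow> ('o, 'm, 'r, 'v) rep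
     \<Rightarrow> bool" where
  "subrepresentation C R N M \<longleftrightarrow>
     (\<forall>x \<in> Obj C. submodule (N x) R (Val M x)) \<and>
     (\<forall>x \<in> Obj C. \<forall>y \<in> Obj C. \<forall>f \<in> Hom C x y. Act M x y f ` N x \<subseteq> N y)"

text \<open>\<open>P\<^sub>x(y)\<close> is free on \<open>Hom(x, y)\<close>, and \<open>f : y \<rightarrow> z\<close> sends a basis element \<open>g\<close> to \<open>f \<circ> g\<close>; so
  the coefficient of \<open>h\<close> in the image of \<open>a\<close> is the sum of the \<open>a g\<close> with \<open>f \<circ> g = h\<close>.\<close>

definition principal_projective ::
  "('o, 'm) category \<Rightarrow> ('r, 'b) ring_scheme \<Rightarrow> 'o \<Rightarrow> ('o, 'm, 'r, 'm \<Rightarrow> 'r) rep" where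
  "principal_projective C R x =
     \<lparr>Val = (\<lambda>y. free_module R (Hom C x y)),
      Act = (\<lambda>y z f a h.
        finsum R a {g \<in> Hom C x y. a g \<noteq> \<zero>\<^bsub>R\<^esub> \<and> Comp C x y z f g = h})\<rparr>"

text \<open>The direct sum of a family indexed by a \<^emph>\<open>finite\<close> set \<open>I\<close>, as families of elements.\<close>

definition finite_direct_sum ::
  "'i set \<Rightarrow> ('i \<Rightarrow> ('o, 'm, 'r, 'v) rep) \<Rightarrow> ('o, 'm, 'r, 'i \<Rightarrow> 'v) rep" where
  "finite_direct_sum I F =
     \<lparr>Val = (\<lambda>y.
        \<lparr>carrier = (\<Pi>\<^sub>E i\<in>I. carrier (Val (F i) y)),
         monoid.mult = undefined, one = undefined,
         ring.zero = (\<lambda>i\<in>I. \<zero>\<^bsub>Val (F i) y\<^esub>),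
         ring.add = (\<lambda>u v. \<lambda>i\<in>I. u i \<oplus>\<^bsub>Val (F i) y\<^esub> v i),
         module.smult = (\<lambda>c u. \<lambda>i\<in>I. c \<odot>\<^bsub>Val (F i) y\<^esub> u i)\<rparr>),
      Act = (\<lambda>y z f u. \<lambda>i\<in>I. Act (F i) y z f (u i))\<rparr>"

definition fin_gen_rep ::
  "('o, 'm) category \<Rightarrow> ('r, 'b) ring_scheme \<Rightarrow> ('o, 'm, 'r, 'v) rep \<Rightarrow> bool" where
  "fin_gen_rep C R M \<longleftrightarrow> representation C R M \<and>
     (\<exists>(n::nat) x. (\<forall>i<n. x i \<in> Obj C) \<and>
        rep_quotient C R (finite_direct_sum {..<n} (\<lambda>i. principal_projective C R (x i))) M)"

definition noetherian_rep ::
  "('o, 'm) category \<Rightarrow> ('r, 'b) ring_scheme \<Rightarrow> ('o, 'm, 'r, 'v) rep \<Rightarrow> bool" where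
  "noetherian_rep C R M \<longleftrightarrow> representation C R M \<and>
     (\<forall>N :: nat \<Rightarrow> 'o \<Rightarrow> 'v set.
        (\<forall>n. subrepresentation C R (N n) M) \<and> (\<forall>n. \<forall>x \<in> Obj C. N n x \<subseteq> N (Suc n) x) \<longrightarrow>
        (\<exists>n0. \<forall>n\<ge>n0. \<forall>x \<in> Obj C. N n x = N n0 x))"

text \<open>The elements of the modules are drawn from a type \<open>'v\<close>, which must be visible in the type of
  the predicate; theorems about it are to be stated for an arbitrary type \<open>'v\<close>.\<close>

definition Rep_noetherian ::
  "('o, 'm) category \<Rightarrow> ('r, 'b) ring_scheme \<Rightarrow> 'v itself \<Rightarrow> bool" where
  "Rep_noetherian C R (_ :: 'v itself) \<longleftrightarrow>
     (\<forall>M :: ('o, 'm, 'r, 'v) rep. fin_gen_rep C R M \<longrightarrow> noetherian_rep C R M)"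

section \<open>The category \<open>FI\<^sub>G\<close>\<close>

definition G_maps ::
  "('g, 'b) monoid_scheme \<Rightarrow> 'x set \<Rightarrow> 'y set \<Rightarrow> (('x \<Rightarrow> 'y) \<times> ('x \<Rightarrow> 'g)) set" where
  "G_maps G S T = (S \<rightarrow>\<^sub>E T) \<times> (S \<rightarrow>\<^sub>E carrier G)"

definition G_map_comp ::
  "('g, 'b) monoid_scheme \<Rightarrow> 'x set \<Rightarrow> ('y \<Rightarrow> 'z) \<times> ('y \<Rightarrow> 'g) \<Rightarrow> ('x \<Rightarrow> 'y) \<times> ('x \<Rightarrow> 'g)
     \<Rightarrow> ('x \<Rightarrow> 'z) \<times> ('x \<Rightarrow> 'g)" where
  "G_map_comp G S = (\<lambda>(g, \<sigma>) (f, \<rho>). (compose S g f, \<lambda>x\<in>S. \<sigma> (f x) \<otimes>\<^bsub>G\<^esub> \<rho> x))"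

text \<open>The objects are the finite subsets of a fixed type \<open>'x\<close>. If \<open>'x\<close> is infinite, every finite
  set is in bijection with one of them, so this is \<open>FI\<^sub>G\<close> up to equivalence of categories.\<close>

definition FI :: "('g, 'b) monoid_scheme \<Rightarrow> ('x set, ('x \<Rightarrow> 'x) \<times> ('x \<Rightarrow> 'g)) category" where
  "FI G =
     \<lparr>Obj = {S. finite S},
      Hom = (\<lambda>S T. {(f, \<rho>). (f, \<rho>) \<in> G_maps G S T \<and> inj_on f S}),
      Comp = (\<lambda>S T U. G_map_comp G S),
      Ident = (\<lambda>S. (\<lambda>x\<in>S. x, \<lambda>x\<in>S. \<one>\<^bsub>G\<^esub>))\<rparr>"

section \<open>Sanity checks\<close>

lemma category_FI:
  assumes "group G"
  shows "category (FI G)"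
proof -
  interpret group G by fact
  show ?thesis
  proof
    fix x y z :: "'x set" and f g
    assume "x \<in> Obj (FI G)" "y \<in> Obj (FI G)" "z \<in> Obj (FI G)"
      "f \<in> Hom (FI G) x y" "g \<in> Hom (FI G) y z"
    then show "Comp (FI G) x y z g f \<in> Hom (FI G) x z"
      by (cases f; cases g)
        (auto simp: FI_def G_maps_def G_map_comp_def compose_def inj_on_def PiE_iff)
  next
    fix w x y z :: "'x set" and f g h
    assume "f \<in> Hom (FI G) w x" "g \<in> Hom (FI G) x y" "h \<in> Hom (FI G) y z"
    then show "Comp (FI G) w y z h (Comp (FI G) w x y g f)
        = Comp (FI G) w x z (Comp (FI G) x y z h g) f"
      by (cases f; cases g; cases h)
        (auto simp: FI_def G_maps_def G_map_comp_def compose_def PiE_iff fun_eq_iff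
          restrict_def m_assoc)
  qed (auto simp: FI_def G_maps_def G_map_comp_def compose_def PiE_iff fun_eq_iff
      restrict_def extensional_def inj_on_def)
qed

lemma left_module_free_module:
  fixes R :: "('r, 'b) ring_scheme" and B :: "'m set"
  assumes "ring R"
  shows "left_module R (free_module R B)"
proof -
  interpret ring R by fact
  have sub: "finite {h. c h \<noteq> \<zero>\<^bsub>R\<^esub>} \<and> {h. c h \<noteq> \<zero>\<^bsub>R\<^esub>} \<subseteq> B"
    if "\<And>h. a h = \<zero>\<^bsub>R\<^esub> \<Longrightarrow> b h = \<zero>\<^bsub>R\<^esub> \<Longrightarrow> c h = \<zero>\<^bsub>R\<^esub>"
      "a \<in> carrier (free_module R B)" "b \<in> carrier (free_module R B)"
    for a b c :: "'m \<Rightarrow> 'r"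
  proof -
    have "{h. c h \<noteq> \<zero>\<^bsub>R\<^esub>} \<subseteq> {h. a h \<noteq> \<zero>\<^bsub>R\<^esub>} \<union> {h. b h \<noteq> \<zero>\<^bsub>R\<^esub>}"
      using that(1) by blast
    then show ?thesis
      using that(2,3) by (auto simp: free_module_def intro: finite_subset)
  qed
  have ab: "abelian_group (free_module R B)"
  proof (rule abelian_groupI)
    fix a b assume ab: "a \<in> carrier (free_module R B)" "b \<in> carrier (free_module R B)"
    show "a \<oplus>\<^bsub>free_module R B\<^esub> b \<in> carrier (free_module R B)"
      using ab sub[OF _ ab, of "\<lambda>h. a h \<oplus>\<^bsub>R\<^esub> b h"] by (auto simp: free_module_def)
  next
    fix a assume a: "a \<in> carrier (free_module R B)"
    have "(\<lambda>h. \<ominus>\<^bsub>R\<^esub> a h) \<in> carrier (free_module R B)"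
      using a sub[OF _ a a, of "\<lambda>h. \<ominus>\<^bsub>R\<^esub> a h"] by (auto simp: free_module_def)
    then show "\<exists>b\<in>carrier (free_module R B).
        b \<oplus>\<^bsub>free_module R B\<^esub> a = \<zero>\<^bsub>free_module R B\<^esub>"
      using a by (intro bexI[of _ "\<lambda>h. \<ominus>\<^bsub>R\<^esub> a h"]) (auto simp: free_module_def l_neg)
  qed (auto simp: free_module_def fun_eq_iff a_assoc a_comm a_lcomm)
  have sm: "c \<odot>\<^bsub>free_module R B\<^esub> a \<in> carrier (free_module R B)"
    if "c \<in> carrier R" "a \<in> carrier (free_module R B)" for c a
    using that sub[OF _ that(2,2), of "\<lambda>h. c \<otimes>\<^bsub>R\<^esub> a h"] by (auto simp: free_module_def)
  show ?thesis
    using sm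
    by (intro left_module.intro left_module_axioms.intro assms ab)
      (auto simp: free_module_def l_distr r_distr m_assoc fun_eq_iff)
qed

lemma left_module_homI:
  assumes "\<And>x. x \<in> carrier M \<Longrightarrow> f x \<in> carrier N"
    and "\<And>x y. \<lbrakk>x \<in> carrier M; y \<in> carrier M\<rbrakk> \<Longrightarrow> f (x \<oplus>\<^bsub>M\<^esub> y) = f x \<oplus>\<^bsub>N\<^esub> f y"
    and "\<And>a x. \<lbrakk>a \<in> carrier R; x \<in> carrier M\<rbrakk> \<Longrightarrow> f (a \<odot>\<^bsub>M\<^esub> x) = a \<odot>\<^bsub>N\<^esub> f x"
  shows "f \<in> left_module_hom R M N"
  using assms by (simp add: left_module_hom_def)

lemma representation_principal_projective:
  assumes "category C" "ring R" "x \<in> Obj C"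
  shows "representation C R (principal_projective C R x)"
proof -
  interpret category C by fact
  interpret ring R by fact
  let ?P = "principal_projective C R x"
  let ?s = "\<lambda>a :: 'b \<Rightarrow> 'c. {g. a g \<noteq> \<zero>\<^bsub>R\<^esub>}"
  have car: "a \<in> carrier (Val ?P y) \<longleftrightarrow>
      (\<forall>h. a h \<in> carrier R) \<and> finite (?s a) \<and> ?s a \<subseteq> Hom C x y" for a y
    by (auto simp: principal_projective_def free_module_def)
  have act: "Act ?P y z f a h = finsum R a {g \<in> A. Comp C x y z f g = h}"
    if "a \<in> carrier (Val ?P y)" "finite A" "?s a \<subseteq> A" "A \<subseteq> Hom C x y" for y z f a h A
  proof -
    have "finsum R a {g \<in> A. Comp C x y z f g = h}
        = finsum R a {g \<in> Hom C x y. a g \<noteq> \<zero>\<^bsub>R\<^esub> \<and> Comp C x y z f g = h}"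
      using that by (intro add.finprod_mono_neutral_cong_right) (auto simp: car)
    then show ?thesis by (simp add: principal_projective_def)
  qed
  have clos: "Act ?P y z f a \<in> carrier (Val ?P z)"
    and supp: "?s (Act ?P y z f a) \<subseteq> Comp C x y z f ` ?s a"
    if "y \<in> Obj C" "z \<in> Obj C" "f \<in> Hom C y z" "a \<in> carrier (Val ?P y)" for y z f a
  proof -
    have a: "\<And>h. a h \<in> carrier R" "finite (?s a)" "?s a \<subseteq> Hom C x y"
      using that(4) by (auto simp: car)
    note A = act[OF that(4) a(2) subset_refl a(3), of z f]
    show supp: "?s (Act ?P y z f a) \<subseteq> Comp C x y z f ` ?s a"
    proof
      fix h assume h: "h \<in> ?s (Act ?P y z f a)"
      have "{g \<in> ?s a. Comp C x y z f g = h} \<noteq> {}"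
      proof
        assume "{g \<in> ?s a. Comp C x y z f g = h} = {}"
        then have "Act ?P y z f a h = \<zero>\<^bsub>R\<^esub>" unfolding A by (simp only: finsum_empty)
        then show False using h by simp
      qed
      then show "h \<in> Comp C x y z f ` ?s a" by blast
    qed
    have "Comp C x y z f ` ?s a \<subseteq> Hom C x z"
      using that(1-3) a(3) Comp_in_Hom[OF assms(3)] by blast
    then show "Act ?P y z f a \<in> carrier (Val ?P z)"
      unfolding car using supp a finite_subset[OF supp] by (auto simp: A intro!: finsum_closed)
  qed
  have hom: "Act ?P y z f \<in> left_module_hom R (Val ?P y) (Val ?P z)"
    if yz: "y \<in> Obj C" "z \<in> Obj C" "f \<in> Hom C y z" for y z f
  proof (rule left_module_homI)
    fix a b assume a: "a \<in> carrier (Val ?P y)" and b: "b \<in> carrier (Val ?P y)"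
    interpret V: left_module R "Val ?P y"
      unfolding principal_projective_def using left_module_free_module[OF assms(2)] by simp
    let ?A = "?s a \<union> ?s b"
    have A: "finite ?A" "?A \<subseteq> Hom C x y" using a b by (auto simp: car)
    have e: "a \<oplus>\<^bsub>Val ?P y\<^esub> b = (\<lambda>h. a h \<oplus>\<^bsub>R\<^esub> b h)"
      by (simp add: principal_projective_def free_module_def)
    have ab: "a \<oplus>\<^bsub>Val ?P y\<^esub> b \<in> carrier (Val ?P y)" using a b by simp
    have s: "?s (a \<oplus>\<^bsub>Val ?P y\<^esub> b) \<subseteq> ?A" unfolding e by auto
    show "Act ?P y z f (a \<oplus>\<^bsub>Val ?P y\<^esub> b) = Act ?P y z f a \<oplus>\<^bsub>Val ?P z\<^esub> Act ?P y z f b"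
    proof
      fix h
      have "Act ?P y z f (a \<oplus>\<^bsub>Val ?P y\<^esub> b) h
          = finsum R (\<lambda>g. a g \<oplus>\<^bsub>R\<^esub> b g) {g \<in> ?A. Comp C x y z f g = h}"
        using act[OF ab A(1) s A(2), of z f h] unfolding e .
      also have "\<dots> = Act ?P y z f a h \<oplus>\<^bsub>R\<^esub> Act ?P y z f b h"
        unfolding act[OF a A(1) Un_upper1 A(2)] act[OF b A(1) Un_upper2 A(2)]
        using a b by (intro finsum_addf) (auto simp: car)
      also have "\<dots> = (Act ?P y z f a \<oplus>\<^bsub>Val ?P z\<^esub> Act ?P y z f b) h"
        by (simp add: principal_projective_def free_module_def)
      finally show "Act ?P y z f (a \<oplus>\<^bsub>Val ?P y\<^esub> b) h
          = (Act ?P y z f a \<oplus>\<^bsub>Val ?P z\<^esub> Act ?P y z f b) h" .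
    qed
  next
    fix c a assume c: "c \<in> carrier R" and a: "a \<in> carrier (Val ?P y)"
    interpret V: left_module R "Val ?P y"
      unfolding principal_projective_def using left_module_free_module[OF assms(2)] by simp
    have A: "finite (?s a)" "?s a \<subseteq> Hom C x y" using a by (auto simp: car)
    have e: "c \<odot>\<^bsub>Val ?P y\<^esub> a = (\<lambda>h. c \<otimes>\<^bsub>R\<^esub> a h)"
      by (simp add: principal_projective_def free_module_def)
    have ca: "c \<odot>\<^bsub>Val ?P y\<^esub> a \<in> carrier (Val ?P y)" using a c by simp
    have s: "?s (c \<odot>\<^bsub>Val ?P y\<^esub> a) \<subseteq> ?s a" unfolding e using c by auto
    show "Act ?P y z f (c \<odot>\<^bsub>Val ?P y\<^esub> a) = c \<odot>\<^bsub>Val ?P z\<^esub> Act ?P y z f a"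
    proof
      fix h
      have "Act ?P y z f (c \<odot>\<^bsub>Val ?P y\<^esub> a) h
          = finsum R (\<lambda>g. c \<otimes>\<^bsub>R\<^esub> a g) {g \<in> ?s a. Comp C x y z f g = h}"
        using act[OF ca A(1) s A(2), of z f h] unfolding e .
      also have "\<dots> = c \<otimes>\<^bsub>R\<^esub> Act ?P y z f a h"
        unfolding act[OF a A(1) subset_refl A(2)]
        using a c A by (intro finsum_rdistr[symmetric]) (auto simp: car)
      also have "\<dots> = (c \<odot>\<^bsub>Val ?P z\<^esub> Act ?P y z f a) h"
        by (simp add: principal_projective_def free_module_def)
      finally show "Act ?P y z f (c \<odot>\<^bsub>Val ?P y\<^esub> a) h = (c \<odot>\<^bsub>Val ?P z\<^esub> Act ?P y z f a) h" .
    qed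
  qed (rule clos[OF yz])
  have ident: "Act ?P y y (Ident C y) a = a"
    if y: "y \<in> Obj C" and a: "a \<in> carrier (Val ?P y)" for y a
  proof
    fix h
    have A: "finite (?s a)" "?s a \<subseteq> Hom C x y" and c: "\<And>h. a h \<in> carrier R"
      using a by (auto simp: car)
    have "{g \<in> ?s a. Comp C x y y (Ident C y) g = h} = (if a h = \<zero>\<^bsub>R\<^esub> then {} else {h})"
      using A(2) Comp_Ident_left[OF assms(3) y] by force
    then have "Act ?P y y (Ident C y) a h = finsum R a (if a h = \<zero>\<^bsub>R\<^esub> then {} else {h})"
      using act[OF a A(1) subset_refl A(2), of y "Ident C y" h] by simp
    then show "Act ?P y y (Ident C y) a h = a h" using c by simp
  qed
  have comp: "Act ?P w z (Comp C w y z g f) a = Act ?P y z g (Act ?P w y f a)"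
    if o: "w \<in> Obj C" "y \<in> Obj C" "z \<in> Obj C" and f: "f \<in> Hom C w y" and g: "g \<in> Hom C y z"
      and a: "a \<in> carrier (Val ?P w)" for w y z f g a
  proof
    fix h
    have A: "finite (?s a)" "?s a \<subseteq> Hom C x w" and c: "\<And>h. a h \<in> carrier R"
      using a by (auto simp: car)
    let ?B = "Comp C x w y f ` ?s a"
    have B: "finite ?B" "?B \<subseteq> Hom C x y"
      using A Comp_in_Hom[OF assms(3) o(1,2) _ f] by auto
    have "Act ?P y z g (Act ?P w y f a) h
        = finsum R (Act ?P w y f a) {k \<in> ?B. Comp C x y z g k = h}"
      by (rule act[OF clos[OF o(1,2) f a] B(1) supp[OF o(1,2) f a] B(2)])
    also have "\<dots> = finsum R (\<lambda>k. finsum R a {u \<in> ?s a. Comp C x w y f u = k})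
        {k \<in> ?B. Comp C x y z g k = h}"
      by (rule arg_cong[where f = "\<lambda>F. finsum R F _"])
        (rule ext, rule act[OF a A(1) subset_refl A(2)])
    also have "\<dots> = finsum R a
        (\<Union>k \<in> {k \<in> ?B. Comp C x y z g k = h}. {u \<in> ?s a. Comp C x w y f u = k})"
      using A B c by (intro add.finprod_UN_disjoint[symmetric]) (auto simp: pairwise_def disjnt_def)
    also have "(\<Union>k \<in> {k \<in> ?B. Comp C x y z g k = h}. {u \<in> ?s a. Comp C x w y f u = k})
        = {u \<in> ?s a. Comp C x w z (Comp C w y z g f) u = h}"
      using A(2) Comp_assoc[OF assms(3) o _ f g] by force
    also have "finsum R a \<dots> = Act ?P w z (Comp C w y z g f) a h"
      by (rule act[OF a A(1) subset_refl A(2), symmetric])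
    finally show "Act ?P w z (Comp C w y z g f) a h = Act ?P y z g (Act ?P w y f a) h" ..
  qed
  have "left_module R (Val ?P y)" for y
    unfolding principal_projective_def using left_module_free_module[OF assms(2)] by simp
  then show ?thesis
    unfolding representation_def using hom ident comp by blast
qed

lemma representation_finite_direct_sum:
  assumes "category C" "ring R" "\<And>i. i \<in> I \<Longrightarrow> representation C R (F i)"
  shows "representation C R (finite_direct_sum I F)"
proof -
  let ?D = "finite_direct_sum I F"
  interpret ring R by fact
  have mod: "left_module R (Val (F i) y)" if "i \<in> I" "y \<in> Obj C" for i y
    using assms(3)[OF that(1)] that(2) by (simp add: representation_def)
  have act: "Act (F i) y z f \<in> left_module_hom R (Val (F i) y) (Val (F i) z)"
    if "i \<in> I" "y \<in> Obj C" "z \<in> Obj C" "f \<in> Hom C y z" for i y z f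
    using assms(3)[OF that(1)] that(2-) by (simp add: representation_def)
  have 1: "left_module R (Val ?D y)" if y: "y \<in> Obj C" for y
  proof -
    note ag = left_module.axioms(2)[OF mod[OF _ y]]
    note am = abelian_group.axioms(1)[OF ag]
    have "abelian_group (Val ?D y)"
    proof (rule abelian_groupI)
      fix u v w assume "u \<in> carrier (Val ?D y)" "v \<in> carrier (Val ?D y)" "w \<in> carrier (Val ?D y)"
      then show "u \<oplus>\<^bsub>Val ?D y\<^esub> v \<oplus>\<^bsub>Val ?D y\<^esub> w
          = u \<oplus>\<^bsub>Val ?D y\<^esub> (v \<oplus>\<^bsub>Val ?D y\<^esub> w)"
        by (auto simp: finite_direct_sum_def PiE_iff fun_eq_iff restrict_def
            abelian_monoid.a_assoc[OF am])
    next
      fix u v assume "u \<in> carrier (Val ?D y)" "v \<in> carrier (Val ?D y)"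
      then show "u \<oplus>\<^bsub>Val ?D y\<^esub> v = v \<oplus>\<^bsub>Val ?D y\<^esub> u"
        by (auto simp: finite_direct_sum_def PiE_iff fun_eq_iff restrict_def
            abelian_monoid.a_comm[OF am])
    next
      fix u assume u: "u \<in> carrier (Val ?D y)"
      show "\<exists>v\<in>carrier (Val ?D y). v \<oplus>\<^bsub>Val ?D y\<^esub> u = \<zero>\<^bsub>Val ?D y\<^esub>"
        using u by (intro bexI[of _ "\<lambda>i\<in>I. \<ominus>\<^bsub>Val (F i) y\<^esub> u i"])
          (auto simp: finite_direct_sum_def PiE_iff fun_eq_iff restrict_def extensional_def
            abelian_group.l_neg[OF ag] abelian_group.a_inv_closed[OF ag])
    qed (auto simp: finite_direct_sum_def PiE_iff fun_eq_iff restrict_def extensional_def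
        abelian_monoid.l_zero[OF am] abelian_monoid.zero_closed[OF am]
        abelian_monoid.a_closed[OF am])
    then show ?thesis
      by (intro left_module.intro left_module_axioms.intro assms(2))
        (auto simp: finite_direct_sum_def PiE_iff fun_eq_iff restrict_def extensional_def
          left_module.smult_closed[OF mod[OF _ y]] left_module.smult_l_distr[OF mod[OF _ y]]
          left_module.smult_r_distr[OF mod[OF _ y]] left_module.smult_assoc1[OF mod[OF _ y]]
          left_module.smult_one[OF mod[OF _ y]])
  qed
  have 2: "Act ?D y z f \<in> left_module_hom R (Val ?D y) (Val ?D z)"
    if "y \<in> Obj C" "z \<in> Obj C" "f \<in> Hom C y z" for y z f
    using act[OF _ that]
    by (intro left_module_homI)
      (auto simp: finite_direct_sum_def PiE_iff fun_eq_iff restrict_def extensional_def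
        left_module_hom_def Pi_iff)
  have 3: "Act ?D y y (Ident C y) u = u" if "y \<in> Obj C" "u \<in> carrier (Val ?D y)" for y u
    using that assms(3)
    by (auto simp: finite_direct_sum_def PiE_iff fun_eq_iff restrict_def extensional_def
        representation_def)
  have 4: "Act ?D w z (Comp C w y z g f) u = Act ?D y z g (Act ?D w y f u)"
    if "w \<in> Obj C" "y \<in> Obj C" "z \<in> Obj C" "f \<in> Hom C w y" "g \<in> Hom C y z"
      "u \<in> carrier (Val ?D w)" for w y z f g u
    using that assms(3)
    by (auto simp: finite_direct_sum_def PiE_iff fun_eq_iff restrict_def representation_def)
  show ?thesis
    unfolding representation_def using 1 2 3 4 by blast
qed

end

theory Submission
  imports Defs "HOL-Library.List_Lexorder"
begin

text \<open>The proof is one leading-term argument, used three times.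

Consider finitely supported functions with values in a ring on sets \<open>B y\<close>, where \<open>y\<close> runs through
the objects of a category whose morphisms act by injections, and families \<open>N\<close> of submodules of these
functions that the morphisms preserve. Break every \<open>B y\<close> into ordered
pieces that are copies of smaller sets \<open>H q\<close>. The parts on the piece \<open>q\<close> of those elements of
\<open>N\<close> that vanish above \<open>q\<close> form a submodule \<open>leading N q\<close> of the functions on
\<open>H q\<close>. It grows with \<open>N\<close>, and also along any morphism that carries one piece to another and respects
the order. If the pieces are well-quasi-ordered by such morphisms and the ascending chain condition
holds on each \<open>H q\<close>, then the leading parts of an ascending chain of families stabilise uniformly
in \<open>q\<close>: otherwise a good subsequence of the pieces at which they keep growing would give a strictly
ascending chain on one \<open>H q\<close>. And families \<open>N \<subseteq> N'\<close> with the same leading parts are equal, by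
subtracting one leading part after another. This is \<open>noetherian_if_coefficients_noetherian\<close>.

For a group acting on itself by left translations, the stable submodules are the left ideals of its
group algebra. The first two applications are a finite extension of groups, where the pieces are
finitely many right cosets (\<open>noetherian_finite_index\<close>), and an extension with cyclic quotient generated
by \<open>t\<close>, where the pieces are the cosets \<open>t\<^sup>n H\<close> for natural \<open>n\<close> and the argument is the one of Hilbert's
basis theorem (\<open>noetherian_cyclic_extension\<close>). Climbing the subnormal series of \<open>G\<close>, one coordinate
at a time, gives P. Hall's theorem for the powers of \<open>G\<close>
(\<open>noetherian_power_polycyclic_by_finite\<close>).

The third application is \<open>FI\<^sub>G\<close> itself. A finite sum of principal projectives at \<open>y\<close> has a basis
of triples \<open>(i, f, \<rho>)\<close> with \<open>f\<close> an injection into \<open>y\<close>; the pieces are the pairs \<open>(i, f)\<close>, and the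
labellings \<open>\<rho>\<close> form a power of \<open>G\<close>. On the objects \<open>{0, ..., m - 1}\<close> the injections are ordered
lexicographically, an order that increasing maps respect, and Dickson's lemma shows that increasing
maps well-quasi-order them (\<open>noetherian_FI_diagram\<close>). Pulling chains back along a surjection from a
sum of principal projectives gives the theorem.\<close>

section \<open>Submodules of linearised diagrams of sets\<close>

lemma submodule_free_module_iff:
  assumes "ring R"
  shows "submodule I R (free_module R B) \<longleftrightarrow>
    I \<subseteq> carrier (free_module R B) \<and> (\<lambda>b. \<zero>\<^bsub>R\<^esub>) \<in> I \<and>
    (\<forall>a\<in>I. \<forall>b\<in>I. (\<lambda>h. a h \<oplus>\<^bsub>R\<^esub> b h) \<in> I) \<and>
    (\<forall>c\<in>carrier R. \<forall>a\<in>I. (\<lambda>h. c \<otimes>\<^bsub>R\<^esub> a h) \<in> I)" (is "?l \<longleftrightarrow> ?r")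
proof
  assume ?l
  then interpret submodule I R "free_module R B" .
  show ?r
    using subset one_closed m_closed smult_closed by (auto simp: free_module_def)
next
  interpret R: ring R by fact
  interpret M: left_module R "free_module R B" by (rule left_module_free_module[OF assms])
  assume r: ?r
  have neg: "\<ominus>\<^bsub>free_module R B\<^esub> a \<in> I" if "a \<in> I" for a
  proof -
    have a: "a \<in> carrier (free_module R B)" using r that by blast
    have ca: "\<And>h. a h \<in> carrier R" using a by (simp add: free_module_def)
    have I: "(\<lambda>h. (\<ominus>\<^bsub>R\<^esub> \<one>\<^bsub>R\<^esub>) \<otimes>\<^bsub>R\<^esub> a h) \<in> I" using r that by simp
    have "\<ominus>\<^bsub>free_module R B\<^esub> a = (\<lambda>h. (\<ominus>\<^bsub>R\<^esub> \<one>\<^bsub>R\<^esub>) \<otimes>\<^bsub>R\<^esub> a h)"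
    proof (rule M.minus_equality[OF _ a])
      show "(\<lambda>h. (\<ominus>\<^bsub>R\<^esub> \<one>\<^bsub>R\<^esub>) \<otimes>\<^bsub>R\<^esub> a h) \<in> carrier (free_module R B)"
        using I r by blast
    qed (use ca in \<open>auto simp: free_module_def fun_eq_iff R.l_minus R.l_neg\<close>)
    then show ?thesis using I by simp
  qed
  show ?l
  proof (intro submodule.intro subgroup.intro submodule_axioms.intro)
    show "inv\<^bsub>add_monoid (free_module R B)\<^esub> x \<in> I" if "x \<in> I" for x
      using neg[OF that] by (simp add: a_inv_def)
  qed (use r in \<open>auto simp: free_module_def\<close>)
qed

text \<open>The linear extension of an injection \<open>\<mu>\<close> defined on \<open>B\<close>: the value at \<open>b\<close> is moved to \<open>\<mu> b\<close>. It is
only meaningful for \<open>\<mu>\<close> injective on \<open>B\<close>; otherwise the values of a fibre would have to be added.\<close>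

definition push :: "('r, 'c) ring_scheme \<Rightarrow> 'b set \<Rightarrow> ('b \<Rightarrow> 'd) \<Rightarrow> ('b \<Rightarrow> 'r) \<Rightarrow> 'd \<Rightarrow> 'r" where
  "push R B \<mu> a = (\<lambda>d. if d \<in> \<mu> ` B then a (inv_into B \<mu> d) else \<zero>\<^bsub>R\<^esub>)"

lemma push_apply: "inj_on \<mu> B \<Longrightarrow> b \<in> B \<Longrightarrow> push R B \<mu> a (\<mu> b) = a b"
  by (simp add: push_def)

lemma push_outside: "d \<notin> \<mu> ` B \<Longrightarrow> push R B \<mu> a d = \<zero>\<^bsub>R\<^esub>"
  by (simp add: push_def)

lemma push_eqI:
  assumes "inj_on \<mu> B" "\<And>b. b \<in> B \<Longrightarrow> a' (\<mu> b) = a b" "\<And>d. d \<notin> \<mu> ` B \<Longrightarrow> a' d = \<zero>\<^bsub>R\<^esub>"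
  shows "push R B \<mu> a = a'"
  using assms by (auto simp: push_def fun_eq_iff)

lemma push_support: "inj_on \<mu> B \<Longrightarrow> push R B \<mu> a d \<noteq> \<zero>\<^bsub>R\<^esub> \<Longrightarrow> \<exists>b\<in>B. d = \<mu> b \<and> a b \<noteq> \<zero>\<^bsub>R\<^esub>"
  by (auto simp: push_def split: if_splits)

text \<open>The subrepresentations of the linearisation of a diagram of sets and injections. \<open>Mor\<close> gives the maps
of the diagram as bare functions, so that neither identities nor composites have to be mentioned.\<close>

definition stable_family ::
  "('r, 'c) ring_scheme \<Rightarrow> 'o set \<Rightarrow> ('o \<Rightarrow> 'b set) \<Rightarrow> ('o \<Rightarrow> 'o \<Rightarrow> ('b \<Rightarrow> 'b) set)
     \<Rightarrow> ('o \<Rightarrow> ('b \<Rightarrow> 'r) set) \<Rightarrow> bool" where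
  "stable_family R Ob B Mor N \<longleftrightarrow>
     (\<forall>y\<in>Ob. submodule (N y) R (free_module R (B y))) \<and>
     (\<forall>y\<in>Ob. \<forall>y'\<in>Ob. \<forall>\<mu>\<in>Mor y y'. \<forall>a\<in>N y. push R (B y) \<mu> a \<in> N y')"

definition noetherian_diagram ::
  "('r, 'c) ring_scheme \<Rightarrow> 'o set \<Rightarrow> ('o \<Rightarrow> 'b set) \<Rightarrow> ('o \<Rightarrow> 'o \<Rightarrow> ('b \<Rightarrow> 'b) set) \<Rightarrow> bool" where
  "noetherian_diagram R Ob B Mor \<longleftrightarrow>
     (\<forall>N :: nat \<Rightarrow> 'o \<Rightarrow> ('b \<Rightarrow> 'r) set.
        (\<forall>n. stable_family R Ob B Mor (N n)) \<and> (\<forall>n. \<forall>y\<in>Ob. N n y \<subseteq> N (Suc n) y) \<longrightarrow>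
        (\<exists>n0. \<forall>n\<ge>n0. \<forall>y\<in>Ob. N n y = N n0 y))"

text \<open>A diagram with a single object: a set \<open>H\<close> with a set \<open>T\<close> of self-maps.\<close>

abbreviation noetherian_set ::
  "('r, 'c) ring_scheme \<Rightarrow> 'b set \<Rightarrow> ('b \<Rightarrow> 'b) set \<Rightarrow> bool" where
  "noetherian_set R H T \<equiv> noetherian_diagram R {()} (\<lambda>_. H) (\<lambda>_ _. T)"

lemma stable_familyD:
  assumes "ring R" "stable_family R Ob B Mor N" "y \<in> Ob"
  shows "a \<in> N y \<Longrightarrow> a b \<in> carrier R" "a \<in> N y \<Longrightarrow> finite {b. a b \<noteq> \<zero>\<^bsub>R\<^esub>}"
    "a \<in> N y \<Longrightarrow> a b \<noteq> \<zero>\<^bsub>R\<^esub> \<Longrightarrow> b \<in> B y"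
    "(\<lambda>b. \<zero>\<^bsub>R\<^esub>) \<in> N y"
    "a \<in> N y \<Longrightarrow> a' \<in> N y \<Longrightarrow> (\<lambda>b. a b \<oplus>\<^bsub>R\<^esub> a' b) \<in> N y"
    "c \<in> carrier R \<Longrightarrow> a \<in> N y \<Longrightarrow> (\<lambda>b. c \<otimes>\<^bsub>R\<^esub> a b) \<in> N y"
    "y' \<in> Ob \<Longrightarrow> \<mu> \<in> Mor y y' \<Longrightarrow> a \<in> N y \<Longrightarrow> push R (B y) \<mu> a \<in> N y'"
proof -
  have N: "N y \<subseteq> carrier (free_module R (B y)) \<and> (\<lambda>b. \<zero>\<^bsub>R\<^esub>) \<in> N y \<and>
    (\<forall>a\<in>N y. \<forall>b\<in>N y. (\<lambda>h. a h \<oplus>\<^bsub>R\<^esub> b h) \<in> N y) \<and>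
    (\<forall>c\<in>carrier R. \<forall>a\<in>N y. (\<lambda>h. c \<otimes>\<^bsub>R\<^esub> a h) \<in> N y)"
    using assms(2,3) unfolding stable_family_def submodule_free_module_iff[OF assms(1)] by blast
  then have "a \<in> N y \<Longrightarrow> a \<in> carrier (free_module R (B y))" by blast
  then show "a \<in> N y \<Longrightarrow> a b \<in> carrier R" "a \<in> N y \<Longrightarrow> finite {b. a b \<noteq> \<zero>\<^bsub>R\<^esub>}"
    "a \<in> N y \<Longrightarrow> a b \<noteq> \<zero>\<^bsub>R\<^esub> \<Longrightarrow> b \<in> B y"
    by (auto simp: free_module_def)
qed (use assms in \<open>auto simp: stable_family_def submodule_free_module_iff\<close>)

lemma stable_family_minus:
  assumes "ring R" "stable_family R Ob B Mor N" "y \<in> Ob" "a \<in> N y" "a' \<in> N y"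
  shows "(\<lambda>b. a b \<ominus>\<^bsub>R\<^esub> a' b) \<in> N y"
proof -
  interpret ring R by fact
  have c: "\<And>b. a b \<in> carrier R" "\<And>b. a' b \<in> carrier R"
    using stable_familyD(1)[OF assms(1-3)] assms(4,5) by blast+
  have "(\<lambda>b. a b \<oplus>\<^bsub>R\<^esub> (\<ominus>\<^bsub>R\<^esub> \<one>\<^bsub>R\<^esub>) \<otimes>\<^bsub>R\<^esub> a' b) \<in> N y"
    using stable_familyD(5,6)[OF assms(1-3)] assms(4,5) by simp
  also have "(\<lambda>b. a b \<oplus>\<^bsub>R\<^esub> (\<ominus>\<^bsub>R\<^esub> \<one>\<^bsub>R\<^esub>) \<otimes>\<^bsub>R\<^esub> a' b) = (\<lambda>b. a b \<ominus>\<^bsub>R\<^esub> a' b)"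
    using c by (auto simp: minus_eq l_minus)
  finally show ?thesis .
qed

lemma stable_family_one_objectI:
  assumes "ring R"
    and "\<And>a b. a \<in> I \<Longrightarrow> a b \<in> carrier R" "\<And>a. a \<in> I \<Longrightarrow> finite {b. a b \<noteq> \<zero>\<^bsub>R\<^esub>}"
    "\<And>a b. a \<in> I \<Longrightarrow> a b \<noteq> \<zero>\<^bsub>R\<^esub> \<Longrightarrow> b \<in> H"
    "(\<lambda>b. \<zero>\<^bsub>R\<^esub>) \<in> I"
    "\<And>a a'. a \<in> I \<Longrightarrow> a' \<in> I \<Longrightarrow> (\<lambda>b. a b \<oplus>\<^bsub>R\<^esub> a' b) \<in> I"
    "\<And>c a. c \<in> carrier R \<Longrightarrow> a \<in> I \<Longrightarrow> (\<lambda>b. c \<otimes>\<^bsub>R\<^esub> a b) \<in> I"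
    "\<And>\<tau> a. \<tau> \<in> T \<Longrightarrow> a \<in> I \<Longrightarrow> push R H \<tau> a \<in> I"
  shows "stable_family R {()} (\<lambda>_. H) (\<lambda>_ _. T) (\<lambda>_. I)"
proof -
  have "I \<subseteq> carrier (free_module R H)"
    using assms(2-4) by (auto simp: free_module_def)
  then show ?thesis
    unfolding stable_family_def submodule_free_module_iff[OF assms(1)] using assms(5-) by simp
qed

section \<open>Leading parts\<close>

text \<open>An index \<open>q\<close> stands for a piece of \<open>B (ob q)\<close>, parametrised injectively by \<open>p q\<close> from \<open>H q\<close>, and
\<open>U q\<close> contains what is allowed in an element whose leading piece is \<open>q\<close>. Different
pieces may overlap; this lets the powers of a generator of a finite cyclic quotient be treated like
those of a generator of an infinite one.

The assumptions \<open>coefficient_action\<close> and \<open>le\<close> make the leading parts stable under \<open>T q\<close> and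
monotone in \<open>q\<close>. The last two serve to recover a family from its leading parts: once the part on the
piece \<open>q\<close> has been subtracted, an element is supported in some \<open>U q'\<close> of smaller rank, and every
nonzero element can be moved, reversibly, to one that has a leading piece.\<close>

locale leading_parts =
  ring R for R :: "('r, 'c) ring_scheme" (structure) +
  fixes Ob :: "'o set" and B :: "'o \<Rightarrow> 'b set" and Mor :: "'o \<Rightarrow> 'o \<Rightarrow> ('b \<Rightarrow> 'b) set"
    and Q :: "'q set" and ob :: "'q \<Rightarrow> 'o" and le :: "'q \<Rightarrow> 'q \<Rightarrow> bool" and rank :: "'q \<Rightarrow> nat"
    and U :: "'q \<Rightarrow> 'b set"
    and H :: "'q \<Rightarrow> 'h set" and T :: "'q \<Rightarrow> ('h \<Rightarrow> 'h) set" and p :: "'q \<Rightarrow> 'h \<Rightarrow> 'b"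
  assumes Mor_inj: "y \<in> Ob \<Longrightarrow> y' \<in> Ob \<Longrightarrow> \<mu> \<in> Mor y y' \<Longrightarrow> inj_on \<mu> (B y) \<and> \<mu> ` B y \<subseteq> B y'"
    and ob: "q \<in> Q \<Longrightarrow> ob q \<in> Ob"
    and U: "q \<in> Q \<Longrightarrow> U q \<subseteq> B (ob q)"
    and p: "q \<in> Q \<Longrightarrow> inj_on (p q) (H q) \<and> p q ` H q \<subseteq> B (ob q)"
    and T: "q \<in> Q \<Longrightarrow> \<tau> \<in> T q \<Longrightarrow> bij_betw \<tau> (H q) (H q)"
    and coefficient_action: "q \<in> Q \<Longrightarrow> \<tau> \<in> T q \<Longrightarrow>
      \<exists>\<mu>\<in>Mor (ob q) (ob q). (\<forall>h\<in>H q. \<mu> (p q h) = p q (\<tau> h)) \<and> \<mu> ` U q \<subseteq> U q"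
    and le: "q \<in> Q \<Longrightarrow> q' \<in> Q \<Longrightarrow> le q q' \<Longrightarrow> H q = H q' \<and> T q = T q' \<and>
      (\<exists>\<mu>\<in>Mor (ob q) (ob q'). (\<forall>h\<in>H q. \<mu> (p q h) = p q' h) \<and> \<mu> ` U q \<subseteq> U q')"
    and well_quasi_order: "(\<And>n::nat. s n \<in> Q) \<Longrightarrow>
      \<exists>r::nat \<Rightarrow> nat. strict_mono r \<and> (\<forall>i j. i \<le> j \<longrightarrow> le (s (r i)) (s (r j)))"
    and descent: "q \<in> Q \<Longrightarrow> U q \<subseteq> p q ` H q \<or>
      (\<exists>q'\<in>Q. ob q' = ob q \<and> rank q' < rank q \<and> U q - p q ` H q \<subseteq> U q')"
    and exhaustion: "y \<in> Ob \<Longrightarrow> F \<subseteq> B y \<Longrightarrow> finite F \<Longrightarrow> F \<noteq> {} \<Longrightarrow>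
      \<exists>q\<in>Q. \<exists>\<mu>\<in>Mor y (ob q). \<exists>\<nu>\<in>Mor (ob q) y. \<mu> ` F \<subseteq> U q \<and> (\<forall>b\<in>B y. \<nu> (\<mu> b) = b)"
begin

definition leading :: "('o \<Rightarrow> ('b \<Rightarrow> 'r) set) \<Rightarrow> 'q \<Rightarrow> ('h \<Rightarrow> 'r) set" where
  "leading N q = {c. \<exists>z\<in>N (ob q). (\<forall>b. z b \<noteq> \<zero> \<longrightarrow> b \<in> U q) \<and>
     c = (\<lambda>h. if h \<in> H q then z (p q h) else \<zero>)}"

lemma leadingI:
  "z \<in> N (ob q) \<Longrightarrow> (\<And>b. z b \<noteq> \<zero> \<Longrightarrow> b \<in> U q) \<Longrightarrow>
    (\<And>h. h \<in> H q \<Longrightarrow> c h = z (p q h)) \<Longrightarrow> (\<And>h. h \<notin> H q \<Longrightarrow> c h = \<zero>) \<Longrightarrow> c \<in> leading N q"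
  unfolding leading_def by (auto simp: fun_eq_iff)

lemma leadingE:
  assumes "c \<in> leading N q"
  obtains z where "z \<in> N (ob q)" "\<And>b. z b \<noteq> \<zero> \<Longrightarrow> b \<in> U q"
    "\<And>h. h \<in> H q \<Longrightarrow> c h = z (p q h)" "\<And>h. h \<notin> H q \<Longrightarrow> c h = \<zero>"
  using assms unfolding leading_def by auto

lemma leading_stable:
  assumes N: "stable_family R Ob B Mor N" and q: "q \<in> Q"
  shows "stable_family R {()} (\<lambda>_. H q) (\<lambda>_ _. T q) (\<lambda>_. leading N q)"
proof (rule stable_family_one_objectI[OF ring_axioms])
  note D = stable_familyD[OF ring_axioms N ob[OF q]]
  fix c assume c: "c \<in> leading N q"
  then obtain z where z: "z \<in> N (ob q)" "\<And>b. z b \<noteq> \<zero> \<Longrightarrow> b \<in> U q"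
    "\<And>h. h \<in> H q \<Longrightarrow> c h = z (p q h)" "\<And>h. h \<notin> H q \<Longrightarrow> c h = \<zero>"
    by (elim leadingE) blast
  show "c h \<in> carrier R" for h
    using z D(1) by (cases "h \<in> H q") auto
  show "h \<in> H q" if "c h \<noteq> \<zero>" for h using z(4) that by blast
  have "finite (p q -` {b. z b \<noteq> \<zero>} \<inter> H q)"
    using D(2)[OF z(1)] p[OF q] by (intro finite_vimage_IntI) auto
  moreover have "{h. c h \<noteq> \<zero>} \<subseteq> p q -` {b. z b \<noteq> \<zero>} \<inter> H q"
    using z(3,4) by auto (metis z(3))+
  ultimately show "finite {h. c h \<noteq> \<zero>}" by (rule finite_subset[rotated])
  show "(\<lambda>h. c h \<oplus> c' h) \<in> leading N q" if "c' \<in> leading N q" for c'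
  proof -
    from that obtain z' where z': "z' \<in> N (ob q)" "\<And>b. z' b \<noteq> \<zero> \<Longrightarrow> b \<in> U q"
      "\<And>h. h \<in> H q \<Longrightarrow> c' h = z' (p q h)" "\<And>h. h \<notin> H q \<Longrightarrow> c' h = \<zero>"
      by (elim leadingE) blast
    show ?thesis
    proof (rule leadingI[where z = "\<lambda>b. z b \<oplus> z' b"])
      show "b \<in> U q" if "z b \<oplus> z' b \<noteq> \<zero>" for b using that z(2) z'(2) by force
    qed (use z z' D(5) in auto)
  qed
  show "(\<lambda>h. r \<otimes> c h) \<in> leading N q" if "r \<in> carrier R" for r
  proof (rule leadingI[where z = "\<lambda>b. r \<otimes> z b"])
    show "b \<in> U q" if "r \<otimes> z b \<noteq> \<zero>" for b using that z(2) \<open>r \<in> carrier R\<close> by force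
  qed (use z D(6) that in auto)
  show "push R (H q) \<tau> c \<in> leading N q" if \<tau>: "\<tau> \<in> T q" for \<tau>
  proof -
    obtain \<mu> where \<mu>: "\<mu> \<in> Mor (ob q) (ob q)" "\<And>h. h \<in> H q \<Longrightarrow> \<mu> (p q h) = p q (\<tau> h)"
      "\<mu> ` U q \<subseteq> U q"
      using coefficient_action[OF q \<tau>] by blast
    have inj: "inj_on \<mu> (B (ob q))" using Mor_inj[OF ob[OF q] ob[OF q] \<mu>(1)] by simp
    have b: "inj_on \<tau> (H q)" "\<tau> ` H q = H q" using T[OF q \<tau>] by (auto simp: bij_betw_def)
    show ?thesis
    proof (rule leadingI[where z = "push R (B (ob q)) \<mu> z"])
      show "push R (B (ob q)) \<mu> z \<in> N (ob q)" using D(7)[OF ob[OF q] \<mu>(1) z(1)] .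
      show "b \<in> U q" if "push R (B (ob q)) \<mu> z b \<noteq> \<zero>" for b
        using push_support[OF inj that] z(2) \<mu>(3) by blast
      show "push R (H q) \<tau> c h = \<zero>" if "h \<notin> H q" for h
        using that b by (simp add: push_outside)
      fix h assume "h \<in> H q"
      then obtain h0 where h0: "h0 \<in> H q" "h = \<tau> h0" using b(2) by blast
      have "p q h0 \<in> B (ob q)" using p[OF q] h0 by blast
      then show "push R (H q) \<tau> c h = push R (B (ob q)) \<mu> z (p q h)"
        using h0 z(3) push_apply[OF inj, of "p q h0" R z] \<mu>(2) by (simp add: push_apply[OF b(1)])
    qed
  qed
next
  show "(\<lambda>b. \<zero>) \<in> leading N q"
    by (rule leadingI[where z = "\<lambda>_. \<zero>"])
      (use stable_familyD(4)[OF ring_axioms N ob[OF q]] in auto)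
qed

lemma leading_mono_index:
  assumes N: "stable_family R Ob B Mor N" and q: "q \<in> Q" "q' \<in> Q" "le q q'"
  shows "leading N q \<subseteq> leading N q'"
proof
  fix c assume "c \<in> leading N q"
  then obtain z where z: "z \<in> N (ob q)" "\<And>b. z b \<noteq> \<zero> \<Longrightarrow> b \<in> U q"
    "\<And>h. h \<in> H q \<Longrightarrow> c h = z (p q h)" "\<And>h. h \<notin> H q \<Longrightarrow> c h = \<zero>"
    by (elim leadingE) blast
  obtain \<mu> where \<mu>: "H q = H q'" "\<mu> \<in> Mor (ob q) (ob q')"
    "\<And>h. h \<in> H q \<Longrightarrow> \<mu> (p q h) = p q' h" "\<mu> ` U q \<subseteq> U q'"
    using le[OF q] by blast
  have inj: "inj_on \<mu> (B (ob q))" using Mor_inj[OF ob[OF q(1)] ob[OF q(2)] \<mu>(2)] by simp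
  show "c \<in> leading N q'"
  proof (rule leadingI[where z = "push R (B (ob q)) \<mu> z"])
    show "push R (B (ob q)) \<mu> z \<in> N (ob q')"
      using stable_familyD(7)[OF ring_axioms N ob[OF q(1)] ob[OF q(2)] \<mu>(2) z(1)] .
    show "b \<in> U q'" if "push R (B (ob q)) \<mu> z b \<noteq> \<zero>" for b
      using push_support[OF inj that] z(2) \<mu>(4) by blast
    show "c h = \<zero>" if "h \<notin> H q'" for h using that z(4) \<mu>(1) by simp
    fix h assume "h \<in> H q'"
    then have h: "h \<in> H q" using \<mu>(1) by simp
    then have "p q h \<in> B (ob q)" using p[OF q(1)] by blast
    then show "c h = push R (B (ob q)) \<mu> z (p q' h)"
      using z(3)[OF h] push_apply[OF inj, of "p q h" R z] \<mu>(3)[OF h] by simp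
  qed
qed

text \<open>Division with remainder: an element of the larger family agrees on its leading piece with one of the
smaller, and the difference is supported at smaller rank.\<close>

lemma leading_determines:
  assumes N: "stable_family R Ob B Mor N" and N': "stable_family R Ob B Mor N'"
    and sub: "\<And>y. y \<in> Ob \<Longrightarrow> N y \<subseteq> N' y"
    and eq: "\<And>q. q \<in> Q \<Longrightarrow> leading N q = leading N' q" and y: "y \<in> Ob"
  shows "N y = N' y"
proof
  have claim: "z \<in> N (ob q)" if "q \<in> Q" "z \<in> N' (ob q)" "\<And>b. z b \<noteq> \<zero> \<Longrightarrow> b \<in> U q" for q z
    using that
  proof (induction "rank q" arbitrary: q z rule: less_induct)
    case less
    note q = \<open>q \<in> Q\<close>
    note D = stable_familyD[OF ring_axioms N ob[OF q]] and D' = stable_familyD[OF ring_axioms N' ob[OF q]]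
    have "(\<lambda>h. if h \<in> H q then z (p q h) else \<zero>) \<in> leading N q"
      unfolding eq[OF q] by (rule leadingI[where z = z]) (use less.prems in auto)
    then obtain z' where z': "z' \<in> N (ob q)" "\<And>b. z' b \<noteq> \<zero> \<Longrightarrow> b \<in> U q"
      "\<And>h. h \<in> H q \<Longrightarrow> z (p q h) = z' (p q h)"
      by (elim leadingE) (metis (mono_tags, lifting))
    define d where "d = (\<lambda>b. z b \<ominus> z' b)"
    have c: "\<And>b. z b \<in> carrier R" "\<And>b. z' b \<in> carrier R"
      using D'(1) less.prems(2) D(1) z'(1) by blast+
    have dN: "d \<in> N' (ob q)"
      unfolding d_def using sub[OF ob[OF q]] z'(1) less.prems(2)
      by (intro stable_family_minus[OF ring_axioms N' ob[OF q]]) auto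
    have supp: "b \<in> U q - p q ` H q" if "d b \<noteq> \<zero>" for b
    proof -
      have "z b \<noteq> z' b" using that c by (auto simp: d_def r_neg minus_eq)
      then show ?thesis using less.prems(3) z' by force
    qed
    have "d \<in> N (ob q)"
    proof (cases "U q \<subseteq> p q ` H q")
      case True
      then have "d = (\<lambda>_. \<zero>)" using supp by blast
      then show ?thesis using D(4) by simp
    next
      case False
      then obtain q' where q': "q' \<in> Q" "ob q' = ob q" "rank q' < rank q"
        "U q - p q ` H q \<subseteq> U q'"
        using descent[OF q] by blast
      show ?thesis
        using less.hyps[OF q'(3,1), of d] q'(2,4) dN supp by auto
    qed
    then have "(\<lambda>b. d b \<oplus> z' b) \<in> N (ob q)" using D(5) z'(1) by blast
    moreover have "(\<lambda>b. d b \<oplus> z' b) = z"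
      using c by (auto simp: d_def minus_eq a_assoc l_neg)
    ultimately show ?case by simp
  qed
  show "N' y \<subseteq> N y"
  proof
    fix z assume z: "z \<in> N' y"
    note D = stable_familyD[OF ring_axioms N y] and D' = stable_familyD[OF ring_axioms N' y]
    show "z \<in> N y"
    proof (cases "{b. z b \<noteq> \<zero>} = {}")
      case True
      then have "z = (\<lambda>_. \<zero>)" by auto
      then show ?thesis using D(4) by simp
    next
      case False
      then obtain q \<mu> \<nu> where q: "q \<in> Q" "\<mu> \<in> Mor y (ob q)" "\<nu> \<in> Mor (ob q) y"
        "\<mu> ` {b. z b \<noteq> \<zero>} \<subseteq> U q" "\<And>b. b \<in> B y \<Longrightarrow> \<nu> (\<mu> b) = b"
        using exhaustion[OF y _ D'(2)[OF z]] D'(3)[OF z] by blast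
      have i\<mu>: "inj_on \<mu> (B y)" "\<mu> ` B y \<subseteq> B (ob q)"
        and i\<nu>: "inj_on \<nu> (B (ob q))" "\<nu> ` B (ob q) \<subseteq> B y"
        using Mor_inj[OF y ob[OF q(1)] q(2)] Mor_inj[OF ob[OF q(1)] y q(3)] by auto
      let ?z = "push R (B y) \<mu> z"
      have "?z \<in> N (ob q)"
      proof (rule claim[OF q(1)])
        show "?z \<in> N' (ob q)" using D'(7)[OF ob[OF q(1)] q(2) z] .
        show "b \<in> U q" if "?z b \<noteq> \<zero>" for b using push_support[OF i\<mu>(1) that] q(4) by blast
      qed
      then have "push R (B (ob q)) \<nu> ?z \<in> N y"
        using stable_familyD(7)[OF ring_axioms N ob[OF q(1)] y q(3)] by blast
      moreover have "push R (B (ob q)) \<nu> ?z = z"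
      proof (rule push_eqI[OF i\<nu>(1)])
        fix b assume b: "b \<in> B (ob q)"
        have nb: "\<nu> b \<in> B y" using b i\<nu> by blast
        have "\<mu> (\<nu> b) \<in> B (ob q)" using nb i\<mu> by blast
        then have "\<mu> (\<nu> b) = b" using q(5)[OF nb] b i\<nu>(1) by (meson inj_onD)
        then show "z (\<nu> b) = ?z b" using push_apply[OF i\<mu>(1) nb, of R z] by simp
      next
        fix d assume "d \<notin> \<nu> ` B (ob q)"
        then have "d \<notin> B y" using q(5) i\<mu>(2) by (metis image_subset_iff rev_image_eqI)
        then show "z d = \<zero>" using D'(3)[OF z] by blast
      qed
      ultimately show ?thesis by simp
    qed
  qed
qed (use sub y in blast)

text \<open>If the leading parts did not stabilise uniformly, there would be stages \<open>e 0 \<le> e 1 \<le> \<dots>\<close> and pieces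
at which the leading part grows strictly between consecutive stages. Along an ascending subsequence of
these pieces the growth accumulates in the submodules on a single set \<open>H q\<close>.\<close>

theorem noetherian_if_coefficients_noetherian:
  assumes coeff: "\<And>q. q \<in> Q \<Longrightarrow> noetherian_set R (H q) (T q)"
  shows "noetherian_diagram R Ob B Mor"
  unfolding noetherian_diagram_def
proof (intro allI impI, elim conjE)
  fix N :: "nat \<Rightarrow> 'o \<Rightarrow> ('b \<Rightarrow> 'r) set"
  assume st: "\<forall>n. stable_family R Ob B Mor (N n)"
    and inc: "\<forall>n. \<forall>y\<in>Ob. N n y \<subseteq> N (Suc n) y"
  have mono: "N m y \<subseteq> N n y" if "y \<in> Ob" "m \<le> n" for m n y
    using that(2) lift_Suc_mono_le[of "\<lambda>n. N n y" m n] inc that(1) by blast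
  have lmono: "leading (N m) q \<subseteq> leading (N n) q" if "q \<in> Q" "m \<le> n" for m n q
    using mono[OF ob[OF that(1)] that(2)] unfolding leading_def by blast
  have "\<exists>n0. \<forall>n\<ge>n0. \<forall>q\<in>Q. leading (N n) q = leading (N n0) q"
  proof (rule ccontr)
    assume "\<not> ?thesis"
    then have "\<forall>n0. \<exists>n q. n \<ge> n0 \<and> q \<in> Q \<and> leading (N n) q \<noteq> leading (N n0) q" by blast
    then obtain g s where gs: "\<And>m. m \<le> g m" "\<And>m. s m \<in> Q"
      "\<And>m. leading (N (g m)) (s m) \<noteq> leading (N m) (s m)"
      by metis
    have ne: "leading (N m) (s m) \<subset> leading (N (g m)) (s m)" for m
      using lmono[OF gs(2,1)] gs(3) by blast
    \<comment> \<open>At stage \<open>m\<close> the leading part at the piece \<open>s m\<close> has grown by stage \<open>g m\<close>; iterating \<open>g\<close>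
      yields stages between which the growth takes place.\<close>
    define e where "e = rec_nat 0 (\<lambda>_ m. Suc (g m))"
    have e: "e (Suc j) = Suc (g (e j))" for j by (simp add: e_def)
    have ge: "g (e j) \<le> e (Suc j)" "e j \<le> e (Suc j)" for j using gs(1)[of "e j"] e[of j] by auto
    have emono: "mono e" using ge(2) by (intro mono_iff_le_Suc[THEN iffD2]) auto
    obtain r :: "nat \<Rightarrow> nat" where r: "strict_mono r" "\<And>i j. i \<le> j \<Longrightarrow> le (s (e (r i))) (s (e (r j)))"
      using well_quasi_order[of "\<lambda>j. s (e j)", OF gs(2)] by blast
    let ?q = "\<lambda>i. s (e (r i))"
    let ?I = "\<lambda>i. leading (N (e (r i))) (?q i)"
    have step: "?I i \<subset> ?I (Suc i)" for i
    proof -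
      have "Suc (r i) \<le> r (Suc i)" using r(1) by (simp add: Suc_leI strict_monoD)
      then have "g (e (r i)) \<le> e (r (Suc i))"
        using ge(1)[of "r i"] monoD[OF emono] by (meson order_trans)
      then have "leading (N (g (e (r i)))) (?q i) \<subseteq> leading (N (e (r (Suc i)))) (?q i)"
        by (rule lmono[OF gs(2)])
      also have "\<dots> \<subseteq> ?I (Suc i)"
        using leading_mono_index[OF st[rule_format] gs(2) gs(2) r(2)[of i "Suc i"]] by simp
      finally show ?thesis using ne[of "e (r i)"] by blast
    qed
    have HT: "H (?q i) = H (?q 0)" "T (?q i) = T (?q 0)" for i
      using le[OF gs(2) gs(2) r(2)[of 0 i]] by auto
    have "stable_family R {()} (\<lambda>_. H (?q 0)) (\<lambda>_ _. T (?q 0)) (\<lambda>_. ?I i)" for i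
      using leading_stable[OF st[rule_format] gs(2), of "e (r i)" "e (r i)"] HT[of i] by simp
    then have "\<exists>n0. \<forall>n\<ge>n0. \<forall>y\<in>{()}. ?I n = ?I n0"
      using step
      by (intro coeff[OF gs(2), of "e (r 0)", unfolded noetherian_diagram_def, THEN spec[of _ "\<lambda>i _. ?I i"],
            THEN mp]) (auto simp: psubset_eq)
    then obtain n0 where n0: "\<forall>n\<ge>n0. ?I n = ?I n0" by auto
    then have "?I (Suc n0) = ?I n0" using le_SucI[OF order_refl] by blast
    then show False using step[of n0] by simp
  qed
  then obtain n0 where n0: "\<forall>n\<ge>n0. \<forall>q\<in>Q. leading (N n) q = leading (N n0) q" ..
  have "\<forall>n\<ge>n0. \<forall>y\<in>Ob. N n y = N n0 y"
  proof (intro allI impI ballI)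
    fix n y assume n: "n0 \<le> n" and y: "y \<in> Ob"
    have eq: "leading (N n0) q = leading (N n) q" if "q \<in> Q" for q
      using n0 that n by blast
    show "N n y = N n0 y"
      by (rule leading_determines[of "N n0" "N n" y, OF spec[OF st] spec[OF st] mono[OF _ n] eq y, symmetric])
  qed
  then show "\<exists>n0. \<forall>n\<ge>n0. \<forall>y\<in>Ob. N n y = N n0 y" by blast
qed

end

section \<open>Well-quasi-orders of tuples and words\<close>

text \<open>Dickson's lemma for the coordinates in \<open>F\<close>. For a single coordinate, take the positions whose value is
a lower bound of all later ones; there are infinitely many, because every tail has a minimal value.\<close>

lemma dickson:
  fixes F :: "('q \<Rightarrow> nat) set" and s :: "nat \<Rightarrow> 'q"
  assumes "finite F"
  shows "\<exists>r::nat \<Rightarrow> nat. strict_mono r \<and> (\<forall>c\<in>F. \<forall>i j. i \<le> j \<longrightarrow> c (s (r i)) \<le> c (s (r j)))"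
  using assms
proof (induction F rule: finite_induct)
  case empty
  show ?case by (intro exI[of _ id]) (simp add: strict_mono_def)
next
  case (insert c F)
  then obtain r :: "nat \<Rightarrow> nat" where r: "strict_mono r"
    "\<And>c i j. c \<in> F \<Longrightarrow> i \<le> j \<Longrightarrow> c (s (r i)) \<le> c (s (r j))"
    by blast
  define a where "a = (\<lambda>i. c (s (r i)))"
  define W where "W = {i. \<forall>j\<ge>i. a i \<le> a j}"
  have "\<exists>i\<ge>m. i \<in> W" for m
  proof -
    obtain i where i: "i \<ge> m" "\<And>j. j \<ge> m \<Longrightarrow> a i \<le> a j"
      using ex_has_least_nat[of "\<lambda>i. i \<ge> m" m a] by auto
    then show ?thesis unfolding W_def by (intro exI[of _ i]) auto
  qed
  then have W: "infinite W" by (auto simp: infinite_nat_iff_unbounded_le)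
  let ?r = "\<lambda>i. r (enumerate W i)"
  have e: "strict_mono (enumerate W)" by (rule strict_mono_enumerate[OF W])
  have "strict_mono ?r" using r(1) e by (auto simp: strict_mono_def)
  moreover have "c (s (?r i)) \<le> c (s (?r j))" if "i \<le> j" for i j
    using enumerate_in_set[OF W, of i] strict_mono_leD[OF e that] by (auto simp: W_def a_def)
  moreover have "c' (s (?r i)) \<le> c' (s (?r j))" if "i \<le> j" "c' \<in> F" for i j c'
    using r(2)[OF that(2) strict_mono_leD[OF e that(1)]] .
  ultimately show ?case by (intro exI[of _ ?r]) auto
qed

text \<open>The hypotheses on the entries are nondecreasing conditions on finitely many natural numbers, in the form
that Dickson's lemma provides. With truncated subtraction, comparing \<open>Suc (vs ! a) - vs ! b\<close> says for
\<open>vs ! b \<le> vs ! a\<close> that the gap between the two does not shrink; the \<open>Suc\<close> lets this cover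
equal entries, which have to stay equal. So the shifts \<open>ws ! a - vs ! a\<close> grow with \<open>vs ! a\<close>, and moving every
number by the largest shift of an entry below it is strictly increasing.\<close>

lemma strict_mono_extension:
  fixes vs ws :: "nat list"
  assumes len: "length vs = length ws"
    and le: "\<And>a. a < length vs \<Longrightarrow> vs ! a \<le> ws ! a"
    and gap: "\<And>a b. a < length vs \<Longrightarrow> b < length vs \<Longrightarrow> Suc (vs ! a) - vs ! b \<le> Suc (ws ! a) - ws ! b"
  obtains h :: "nat \<Rightarrow> nat" where "strict_mono h" "map h vs = ws"
proof -
  define D where "D y = insert 0 {ws ! a - vs ! a | a. a < length vs \<and> vs ! a \<le> y}" for y
  define h where "h y = y + Max (D y)" for y
  have fin: "finite (D y)" for y unfolding D_def by simp
  have "D y \<subseteq> D z" if "y \<le> z" for y z using that unfolding D_def by fastforce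
  then have "Max (D y) \<le> Max (D z)" if "y \<le> z" for y z
    using that fin by (intro Max_mono) (auto simp: D_def)
  then have "strict_mono h"
    unfolding h_def by (intro strict_monoI add_less_le_mono) auto
  moreover have "h (vs ! a) = ws ! a" if a: "a < length vs" for a
  proof -
    have "Max (D (vs ! a)) = ws ! a - vs ! a"
    proof (rule Max_eqI[OF fin])
      show "ws ! a - vs ! a \<in> D (vs ! a)" using a by (auto simp: D_def)
      fix d assume "d \<in> D (vs ! a)"
      then consider "d = 0" | b where "b < length vs" "vs ! b \<le> vs ! a" "d = ws ! b - vs ! b"
        unfolding D_def by blast
      then show "d \<le> ws ! a - vs ! a"
      proof cases
        case 2
        then show ?thesis using gap[OF a 2(1)] le[OF a] le[OF 2(1)] by linarith
      qed simp
    qed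
    then show ?thesis using le[OF a] by (simp add: h_def)
  qed
  then have "map h vs = ws" using len by (intro nth_equalityI) auto
  ultimately show thesis by (rule that)
qed

text \<open>This makes the lexicographic order of injections compatible with morphisms.\<close>

lemma map_lexorder_mono:
  fixes vs ws :: "nat list"
  assumes "strict_mono h" "vs \<le> ws"
  shows "map h vs \<le> map h ws"
  using assms(2)
proof (induction vs arbitrary: ws)
  case (Cons v vs)
  then obtain w ws' where "ws = w # ws'" "v < w \<or> v = w \<and> vs \<le> ws'" by (cases ws) auto
  then show ?case using Cons.IH assms(1) by (auto simp: strict_monoD)
qed simp

section \<open>Group algebras of polycyclic-by-finite groups\<close>

definition left_translations :: "('a, 'b) monoid_scheme \<Rightarrow> 'a set \<Rightarrow> ('a \<Rightarrow> 'a) set" where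
  "left_translations K H = (\<lambda>g h. g \<otimes>\<^bsub>K\<^esub> h) ` H"

lemma left_translations_bij:
  assumes "group K" "subgroup H K" "\<tau> \<in> left_translations K H"
  shows "bij_betw \<tau> H H"
proof -
  interpret group K by fact
  interpret H: subgroup H K by fact
  obtain g where g: "g \<in> H" "\<tau> = (\<lambda>h. g \<otimes>\<^bsub>K\<^esub> h)" using assms(3) by (auto simp: left_translations_def)
  show ?thesis unfolding g(2)
    by (rule bij_betw_byWitness[where f' = "\<lambda>h. inv\<^bsub>K\<^esub> g \<otimes>\<^bsub>K\<^esub> h"])
      (use g H.subset in \<open>auto simp: m_assoc[symmetric] subset_iff\<close>)
qed

text \<open>Functions supported at one point are elements of the ring, so this is the hypothesis on the ring.\<close>

lemma noetherian_trivial_group: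
  assumes "group K" "left_noetherian k"
  shows "noetherian_set k {\<one>\<^bsub>K\<^esub>} (left_translations K {\<one>\<^bsub>K\<^esub>})"
  unfolding noetherian_diagram_def
proof (intro allI impI, elim conjE)
  interpret k: ring k using assms(2) by (simp add: left_noetherian_def)
  let ?e = "\<one>\<^bsub>K\<^esub>"
  fix N :: "nat \<Rightarrow> unit \<Rightarrow> ('a \<Rightarrow> 'c) set"
  assume st: "\<forall>n. stable_family k {()} (\<lambda>_. {?e}) (\<lambda>_ _. left_translations K {?e}) (N n)"
    and inc: "\<forall>n. \<forall>y\<in>{()}. N n y \<subseteq> N (Suc n) y"
  note D = stable_familyD[OF k.ring_axioms st[rule_format], of "()", simplified]
  define I where "I n = (\<lambda>a. a ?e) ` N n ()" for n
  have "left_ideal (I n) k" for n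
    unfolding left_ideal_def
  proof (intro conjI ballI k.add.subgroupI)
    show "I n \<subseteq> carrier k" using D(1) by (auto simp: I_def)
    show "I n \<noteq> {}" using D(4) by (auto simp: I_def)
    fix x assume "x \<in> I n"
    then obtain a where a: "a \<in> N n ()" "x = a ?e" by (auto simp: I_def)
    show "c \<otimes>\<^bsub>k\<^esub> x \<in> I n" if "c \<in> carrier k" for c
      unfolding I_def using D(6)[OF that a(1)] a(2) by (auto intro: rev_image_eqI)
    then have "(\<ominus>\<^bsub>k\<^esub> \<one>\<^bsub>k\<^esub>) \<otimes>\<^bsub>k\<^esub> x \<in> I n" by simp
    then show "\<ominus>\<^bsub>k\<^esub> x \<in> I n" using D(1)[OF a(1)] a(2) by (simp add: k.l_minus)
    fix x' assume "x' \<in> I n"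
    then obtain a' where a': "a' \<in> N n ()" "x' = a' ?e" by (auto simp: I_def)
    show "x \<oplus>\<^bsub>k\<^esub> x' \<in> I n"
      unfolding I_def using D(5)[OF a(1) a'(1)] a(2) a'(2) by (auto intro: rev_image_eqI)
  qed
  moreover have "I n \<subseteq> I (Suc n)" for n using inc unfolding I_def by blast
  ultimately have "(\<forall>n. left_ideal (I n) k) \<and> (\<forall>n. I n \<subseteq> I (Suc n))" by blast
  then have "\<exists>n0. \<forall>n\<ge>n0. I n = I n0"
    by (rule assms(2)[unfolded left_noetherian_def, THEN conjunct2, THEN spec[of _ I], THEN mp])
  then obtain n0 where n0: "\<forall>n\<ge>n0. I n = I n0" ..
  have det: "a = a'" if "a \<in> N n ()" "a' \<in> N m ()" "a ?e = a' ?e" for a a' n m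
  proof
    fix x show "a x = a' x"
    proof (cases "x = ?e")
      case True
      then show ?thesis by (simp only: that(3))
    next
      case False
      then have "a x = \<zero>\<^bsub>k\<^esub>" "a' x = \<zero>\<^bsub>k\<^esub>" using D(3)[OF that(1), of x] D(3)[OF that(2), of x] by blast+
      then show ?thesis by (simp only:)
    qed
  qed
  have "N n () = N n0 ()" if "n \<ge> n0" for n
  proof -
    have "I n = I n0" using n0 that by blast
    show ?thesis
    proof (intro equalityI subsetI)
      fix a assume a: "a \<in> N n ()"
      then have "a ?e \<in> I n0" unfolding \<open>I n = I n0\<close>[symmetric] by (auto simp: I_def)
      then obtain a' where "a' \<in> N n0 ()" "a ?e = a' ?e" by (auto simp: I_def)
      then show "a \<in> N n0 ()" using det[OF a] by metis
    next
      fix a assume a: "a \<in> N n0 ()"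
      then have "a ?e \<in> I n" unfolding \<open>I n = I n0\<close> by (auto simp: I_def)
      then obtain a' where "a' \<in> N n ()" "a ?e = a' ?e" by (auto simp: I_def)
      then show "a \<in> N n ()" using det[OF a] by metis
    qed
  qed
  then have "\<forall>n\<ge>n0. \<forall>y\<in>{()}. N n y = N n0 y" by blast
  then show "\<exists>n0. \<forall>n\<ge>n0. \<forall>y\<in>{()}. N n y = N n0 y" ..
qed

text \<open>Left translation by an element of \<open>H\<close> preserves every right coset \<open>H c\<close>, so the finitely many right
cosets, in any order, can serve as pieces, compared only with themselves.\<close>

lemma noetherian_finite_index:
  assumes "group K" "ring k" "subgroup H K" "subgroup H' K" "H \<subseteq> H'"
    and C: "finite C" "C \<subseteq> H'" "H' = (\<Union>c\<in>C. (\<lambda>h. h \<otimes>\<^bsub>K\<^esub> c) ` H)"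
    and noeth: "noetherian_set k H (left_translations K H)"
  shows "noetherian_set k H' (left_translations K H')"
proof -
  interpret K: group K by fact
  interpret H: subgroup H K by fact
  interpret H': subgroup H' K by fact
  define r where "r = card C"
  obtain c where c: "C = c ` {..<r}"
    using ex_bij_betw_nat_finite[OF C(1)] unfolding r_def atLeast0LessThan bij_betw_def by blast
  have cH: "c j \<in> H'" if "j < r" for j using c C(2) that by blast
  have "C \<noteq> {}" using C(3) H'.one_closed by blast
  then have r0: "r > 0" using C(1) by (simp add: r_def card_gt_0_iff)
  let ?p = "\<lambda>j h. h \<otimes>\<^bsub>K\<^esub> c j"
  let ?U = "\<lambda>n. \<Union>j\<le>n. ?p j ` H"
  have "{..<r} = {..r - 1}" using r0 by auto
  then have cover: "H' = ?U (r - 1)"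
    using C(3) unfolding c image_image by simp
  interpret leading_parts k "{()}" "\<lambda>_. H'" "\<lambda>_ _. left_translations K H'"
    "{..<r}" "\<lambda>_. ()" "(=)" id ?U "\<lambda>_. H" "\<lambda>_. left_translations K H" ?p
  proof (intro leading_parts.intro leading_parts_axioms.intro assms(2))
    show "inj_on \<mu> H' \<and> \<mu> ` H' \<subseteq> H'" if "\<mu> \<in> left_translations K H'" for \<mu>
      using left_translations_bij[OF assms(1,4) that] by (auto simp: bij_betw_def)
    show "?U n \<subseteq> H'" if "n \<in> {..<r}" for n
      using that cH assms(5) by (auto intro!: H'.m_closed)
    show "inj_on (?p n) H \<and> ?p n ` H \<subseteq> H'" if "n \<in> {..<r}" for n
    proof
      have "c n \<in> H'" using cH[of n] that by simp
      then show "inj_on (?p n) H" "?p n ` H \<subseteq> H'"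
        using H.subset H'.subset assms(5) by (auto simp: inj_on_def subset_iff)
    qed
    show "bij_betw \<tau> H H" if "\<tau> \<in> left_translations K H" for \<tau>
      using left_translations_bij[OF assms(1,3) that] .
    show "\<exists>\<mu>\<in>left_translations K H'. (\<forall>h\<in>H. \<mu> (?p n h) = ?p n (\<tau> h)) \<and> \<mu> ` ?U n \<subseteq> ?U n"
      if n: "n \<in> {..<r}" and \<tau>: "\<tau> \<in> left_translations K H" for n \<tau>
    proof -
      obtain g where g: "g \<in> H" "\<tau> = (\<lambda>h. g \<otimes>\<^bsub>K\<^esub> h)" using \<tau> by (auto simp: left_translations_def)
      have "g \<otimes>\<^bsub>K\<^esub> ?p j h = ?p j (g \<otimes>\<^bsub>K\<^esub> h)" if "j \<le> n" "h \<in> H" for j h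
        using g that n cH[of j] H.subset H'.subset by (auto simp: K.m_assoc subset_iff)
      moreover have "\<tau> \<in> left_translations K H'" using g assms(5) by (auto simp: left_translations_def)
      ultimately show ?thesis using g by (intro bexI[of _ \<tau>]) auto
    qed
    show "H = H \<and> left_translations K H = left_translations K H \<and>
      (\<exists>\<mu>\<in>left_translations K H'. (\<forall>h\<in>H. \<mu> (?p n h) = ?p m h) \<and> \<mu> ` ?U n \<subseteq> ?U m)"
      if n: "n \<in> {..<r}" and "n = m" for n m
    proof -
      have "\<one>\<^bsub>K\<^esub> \<otimes>\<^bsub>K\<^esub> ?p j h = ?p j h" if "j \<le> n" "h \<in> H" for j h
        using that n cH[of j] H.subset H'.subset by (auto simp: subset_iff)
      then show ?thesis using \<open>n = m\<close>
        by (intro conjI refl bexI[of _ "\<lambda>h. \<one>\<^bsub>K\<^esub> \<otimes>\<^bsub>K\<^esub> h"]) (auto simp: left_translations_def)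
    qed
    show "\<exists>q::nat \<Rightarrow> nat. strict_mono q \<and> (\<forall>i j. i \<le> j \<longrightarrow> s (q i) = s (q j))"
      if s: "\<And>n::nat. s n \<in> {..<r}" for s :: "nat \<Rightarrow> nat"
    proof -
      \<comment> \<open>A value that is bounded by \<open>r\<close> is constant once it and its distance to \<open>r\<close> both increase.\<close>
      obtain q :: "nat \<Rightarrow> nat" where q: "strict_mono q"
        "\<forall>c\<in>{id, \<lambda>m. r - m}. \<forall>i j. i \<le> j \<longrightarrow> c (s (q i)) \<le> c (s (q j))"
        using dickson[of "{id, \<lambda>m. r - m}" s] by auto
      have "s (q i) = s (q j)" if "i \<le> j" for i j
      proof -
        have "s (q i) \<le> s (q j)" "r - s (q i) \<le> r - s (q j)" using q(2) that by auto
        then show ?thesis using s[of "q i"] s[of "q j"] by simp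
      qed
      then show ?thesis using q(1) by blast
    qed
    show "?U n \<subseteq> ?p n ` H \<or> (\<exists>m\<in>{..<r}. () = () \<and> id m < id n \<and> ?U n - ?p n ` H \<subseteq> ?U m)"
      if "n \<in> {..<r}" for n
    proof (cases n)
      case (Suc m)
      have "?U n - ?p n ` H \<subseteq> ?U m" unfolding Suc atMost_Suc UN_insert by blast
      then show ?thesis using that Suc by (intro disjI2 bexI[of _ m]) simp_all
    qed auto
    show "\<exists>q\<in>{..<r}. \<exists>\<mu>\<in>left_translations K H'. \<exists>\<nu>\<in>left_translations K H'.
        \<mu> ` F \<subseteq> ?U q \<and> (\<forall>b\<in>H'. \<nu> (\<mu> b) = b)"
      if "F \<subseteq> H'" for F
    proof -
      let ?i = "\<lambda>h. \<one>\<^bsub>K\<^esub> \<otimes>\<^bsub>K\<^esub> h"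
      have i: "?i h = h" if "h \<in> H'" for h using that H'.subset by auto
      have "?i ` F \<subseteq> H'" using that i by auto
      then have "?i ` F \<subseteq> ?U (r - 1)" using cover by simp
      moreover have "?i \<in> left_translations K H'" by (auto simp: left_translations_def)
      moreover have "\<forall>h\<in>H'. ?i (?i h) = h" using i by simp
      moreover have "r - 1 \<in> {..<r}" using r0 by simp
      ultimately show ?thesis by blast
    qed
  qed auto
  show ?thesis using noetherian_if_coefficients_noetherian noeth by blast
qed

text \<open>Hilbert's basis theorem for skew Laurent polynomials in \<open>t\<close> over the group algebra of \<open>H\<close>. The
coefficients stand to the right of the powers of \<open>t\<close>: translation by \<open>t\<close> then shifts the degree and
leaves the coefficient as it is, while translation by \<open>H\<close> acts on the coefficients through conjugation
by powers of \<open>t\<close>. The same argument covers a generator of finite order modulo \<open>H\<close>, although the cosets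
\<open>t\<^sup>n H\<close> then repeat.\<close>

lemma noetherian_cyclic_extension:
  assumes "group K" "ring k" "subgroup H K" "subgroup H' K" "H \<subseteq> H'"
    and t: "t \<in> H'" "\<And>h. h \<in> H \<Longrightarrow> t \<otimes>\<^bsub>K\<^esub> h \<otimes>\<^bsub>K\<^esub> inv\<^bsub>K\<^esub> t \<in> H"
      "\<And>h. h \<in> H \<Longrightarrow> inv\<^bsub>K\<^esub> t \<otimes>\<^bsub>K\<^esub> h \<otimes>\<^bsub>K\<^esub> t \<in> H"
    and gen: "\<And>g. g \<in> H' \<Longrightarrow> \<exists>n::int. \<exists>h\<in>H. g = t [^]\<^bsub>K\<^esub> n \<otimes>\<^bsub>K\<^esub> h"
    and noeth: "noetherian_set k H (left_translations K H)"
  shows "noetherian_set k H' (left_translations K H')"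
proof -
  interpret K: group K by fact
  interpret H: subgroup H K by fact
  interpret H': subgroup H' K by fact
  note HK = subsetD[OF H.subset] and H'K = subsetD[OF H'.subset] and HH' = subsetD[OF assms(5)]
  have tK: "t \<in> carrier K" using t(1) H'K by blast
  have tn: "t [^]\<^bsub>K\<^esub> n \<in> H'" for n :: nat
    by (induction n) (use t(1) in auto)
  have tn': "t [^]\<^bsub>K\<^esub> n \<in> carrier K" for n :: nat using tK by simp
  have conj: "t [^]\<^bsub>K\<^esub> n \<otimes>\<^bsub>K\<^esub> h \<otimes>\<^bsub>K\<^esub> inv\<^bsub>K\<^esub> (t [^]\<^bsub>K\<^esub> n) \<in> H" if "h \<in> H" for n :: nat and h
    using that
  proof (induction n arbitrary: h)
    case 0
    then show ?case using HK by simp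
  next
    case (Suc n)
    have "t [^]\<^bsub>K\<^esub> n \<otimes>\<^bsub>K\<^esub> (t \<otimes>\<^bsub>K\<^esub> h \<otimes>\<^bsub>K\<^esub> inv\<^bsub>K\<^esub> t) \<otimes>\<^bsub>K\<^esub> inv\<^bsub>K\<^esub> (t [^]\<^bsub>K\<^esub> n) \<in> H"
      using Suc t(2) by blast
    then show ?case using tK HK[OF Suc.prems] by (simp add: K.m_assoc K.inv_mult_group)
  qed
  let ?p = "\<lambda>(j::nat) h. t [^]\<^bsub>K\<^esub> j \<otimes>\<^bsub>K\<^esub> h"
  let ?U = "\<lambda>n. \<Union>j\<le>n. ?p j ` H"
  have padd: "t [^]\<^bsub>K\<^esub> (m::nat) \<otimes>\<^bsub>K\<^esub> ?p j h = ?p (m + j) h" if "h \<in> H" for m j h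
    using HK[OF that] tK by (simp add: K.m_assoc[symmetric] K.nat_pow_mult)
  interpret leading_parts k "{()}" "\<lambda>_. H'" "\<lambda>_ _. left_translations K H'"
    UNIV "\<lambda>_. ()" "(\<le>)" id ?U "\<lambda>_. H" "\<lambda>_. left_translations K H" ?p
  proof (intro leading_parts.intro leading_parts_axioms.intro assms(2))
    show "inj_on \<mu> H' \<and> \<mu> ` H' \<subseteq> H'" if "\<mu> \<in> left_translations K H'" for \<mu>
      using left_translations_bij[OF assms(1,4) that] by (auto simp: bij_betw_def)
    show "?U n \<subseteq> H'" for n
      using HH' tn by (auto intro!: H'.m_closed)
    show "inj_on (?p n) H \<and> ?p n ` H \<subseteq> H'" for n
      using HH' tn HK tn' by (auto intro!: H'.m_closed inj_onI)
    show "bij_betw \<tau> H H" if "\<tau> \<in> left_translations K H" for \<tau>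
      using left_translations_bij[OF assms(1,3) that] .
    show "\<exists>\<mu>\<in>left_translations K H'. (\<forall>h\<in>H. \<mu> (?p n h) = ?p n (\<tau> h)) \<and> \<mu> ` ?U n \<subseteq> ?U n"
      if \<tau>: "\<tau> \<in> left_translations K H" for n \<tau>
    proof -
      obtain g where g: "g \<in> H" "\<tau> = (\<lambda>h. g \<otimes>\<^bsub>K\<^esub> h)" using \<tau> by (auto simp: left_translations_def)
      let ?g = "t [^]\<^bsub>K\<^esub> n \<otimes>\<^bsub>K\<^esub> g \<otimes>\<^bsub>K\<^esub> inv\<^bsub>K\<^esub> (t [^]\<^bsub>K\<^esub> n)"
      have gH: "?g \<in> H'" using g(1) HH' tn by simp
      \<comment> \<open>On degree \<open>j \<le> n\<close>, translation by \<open>t\<^sup>n g t\<^sup>-\<^sup>n\<close> acts on coefficients through \<open>t\<^sup>n\<^sup>-\<^sup>j g t\<^sup>j\<^sup>-\<^sup>n\<close>.\<close>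
      have g1: "?g \<otimes>\<^bsub>K\<^esub> ?p j h = ?p j ((t [^]\<^bsub>K\<^esub> (n - j) \<otimes>\<^bsub>K\<^esub> g \<otimes>\<^bsub>K\<^esub> inv\<^bsub>K\<^esub> (t [^]\<^bsub>K\<^esub> (n - j))) \<otimes>\<^bsub>K\<^esub> h)"
        if "j \<le> n" "h \<in> H" for j h
      proof -
        have n: "t [^]\<^bsub>K\<^esub> n = t [^]\<^bsub>K\<^esub> j \<otimes>\<^bsub>K\<^esub> t [^]\<^bsub>K\<^esub> (n - j)" "t [^]\<^bsub>K\<^esub> n = t [^]\<^bsub>K\<^esub> (n - j) \<otimes>\<^bsub>K\<^esub> t [^]\<^bsub>K\<^esub> j"
          using that(1) tK by (simp_all add: K.nat_pow_mult)
        have "inv\<^bsub>K\<^esub> (t [^]\<^bsub>K\<^esub> n) = inv\<^bsub>K\<^esub> (t [^]\<^bsub>K\<^esub> j) \<otimes>\<^bsub>K\<^esub> inv\<^bsub>K\<^esub> (t [^]\<^bsub>K\<^esub> (n - j))"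
          unfolding n(2) using tK by (simp add: K.inv_mult_group)
        moreover have "inv\<^bsub>K\<^esub> (t [^]\<^bsub>K\<^esub> n) = inv\<^bsub>K\<^esub> (t [^]\<^bsub>K\<^esub> (n - j)) \<otimes>\<^bsub>K\<^esub> inv\<^bsub>K\<^esub> (t [^]\<^bsub>K\<^esub> j)"
          unfolding n(1) using tK by (simp add: K.inv_mult_group)
        ultimately have "?g = t [^]\<^bsub>K\<^esub> j \<otimes>\<^bsub>K\<^esub> t [^]\<^bsub>K\<^esub> (n - j) \<otimes>\<^bsub>K\<^esub> g \<otimes>\<^bsub>K\<^esub> (inv\<^bsub>K\<^esub> (t [^]\<^bsub>K\<^esub> (n - j)) \<otimes>\<^bsub>K\<^esub> inv\<^bsub>K\<^esub> (t [^]\<^bsub>K\<^esub> j))"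
          using n(1) by simp
        moreover have "inv\<^bsub>K\<^esub> (t [^]\<^bsub>K\<^esub> j) \<otimes>\<^bsub>K\<^esub> (t [^]\<^bsub>K\<^esub> j \<otimes>\<^bsub>K\<^esub> h) = h"
          using tn' HK[OF that(2)] by (simp add: K.m_assoc[symmetric])
        ultimately show ?thesis
          using tn' HK[OF that(2)] HK[OF g(1)] by (simp add: K.m_assoc)
      qed
      show ?thesis
      proof (intro bexI[of _ "\<lambda>h. ?g \<otimes>\<^bsub>K\<^esub> h"] conjI ballI subsetI)
        show "?g \<otimes>\<^bsub>K\<^esub> ?p n h = ?p n (\<tau> h)" if "h \<in> H" for h
          using g1[OF order_refl that] HK[OF g(1)] g(2) by simp
        show "(\<lambda>h. ?g \<otimes>\<^bsub>K\<^esub> h) \<in> left_translations K H'" using gH by (auto simp: left_translations_def)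
        fix x assume "x \<in> (\<lambda>h. ?g \<otimes>\<^bsub>K\<^esub> h) ` ?U n"
        then obtain j h where j: "j \<le> n" "h \<in> H" "x = ?g \<otimes>\<^bsub>K\<^esub> ?p j h" by blast
        then show "x \<in> ?U n" using g1[OF j(1,2)] conj[OF g(1), of "n - j"] j by blast
      qed
    qed
    show "H = H \<and> left_translations K H = left_translations K H \<and>
      (\<exists>\<mu>\<in>left_translations K H'. (\<forall>h\<in>H. \<mu> (?p n h) = ?p m h) \<and> \<mu> ` ?U n \<subseteq> ?U m)"
      if "n \<le> m" for n m
    proof (intro conjI refl bexI[of _ "\<lambda>h. t [^]\<^bsub>K\<^esub> (m - n) \<otimes>\<^bsub>K\<^esub> h"] ballI subsetI)
      show "t [^]\<^bsub>K\<^esub> (m - n) \<otimes>\<^bsub>K\<^esub> ?p n h = ?p m h" if "h \<in> H" for h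
        using padd[OF that] \<open>n \<le> m\<close> by simp
      show "(\<lambda>h. t [^]\<^bsub>K\<^esub> (m - n) \<otimes>\<^bsub>K\<^esub> h) \<in> left_translations K H'"
        using tn by (auto simp: left_translations_def)
      fix x assume "x \<in> (\<lambda>h. t [^]\<^bsub>K\<^esub> (m - n) \<otimes>\<^bsub>K\<^esub> h) ` ?U n"
      then obtain j h where j: "j \<le> n" "h \<in> H" "x = t [^]\<^bsub>K\<^esub> (m - n) \<otimes>\<^bsub>K\<^esub> ?p j h" by blast
      then have "x = ?p (m - n + j) h" "m - n + j \<le> m" using padd that by auto
      then show "x \<in> ?U m" using j(2) by blast
    qed
    show "\<exists>q::nat \<Rightarrow> nat. strict_mono q \<and> (\<forall>i j. i \<le> j \<longrightarrow> s (q i) \<le> s (q j))"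
      for s :: "nat \<Rightarrow> nat"
      using dickson[of "{id}" s] by simp
    show "?U n \<subseteq> ?p n ` H \<or> (\<exists>m\<in>UNIV. () = () \<and> id m < id n \<and> ?U n - ?p n ` H \<subseteq> ?U m)" for n
    proof (cases n)
      case (Suc m)
      have "?U n - ?p n ` H \<subseteq> ?U m" unfolding Suc atMost_Suc UN_insert by blast
      then show ?thesis using Suc by (intro disjI2 bexI[of _ m]) simp_all
    qed auto
    show "\<exists>q\<in>UNIV. \<exists>\<mu>\<in>left_translations K H'. \<exists>\<nu>\<in>left_translations K H'.
        \<mu> ` F \<subseteq> ?U q \<and> (\<forall>b\<in>H'. \<nu> (\<mu> b) = b)"
      if F: "F \<subseteq> H'" "finite F" for F
    proof -
      obtain e d where e: "\<And>g. g \<in> F \<Longrightarrow> d g \<in> H \<and> g = t [^]\<^bsub>K\<^esub> (e g :: int) \<otimes>\<^bsub>K\<^esub> d g"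
        using gen F(1) by (metis subsetD)
      \<comment> \<open>Degrees may be negative; translation by \<open>t\<^sup>M\<close> puts them all between \<open>0\<close> and \<open>2M\<close>.\<close>
      define M where "M = (\<Sum>g\<in>F. nat \<bar>e g\<bar>)"
      have M: "\<bar>e g\<bar> \<le> int M" if "g \<in> F" for g
        using member_le_sum[of g F "\<lambda>g. nat \<bar>e g\<bar>"] that F(2) by (simp add: M_def nat_le_iff)
      let ?T = "t [^]\<^bsub>K\<^esub> M"
      have "?T \<otimes>\<^bsub>K\<^esub> g \<in> ?U (2 * M)" if "g \<in> F" for g
      proof -
        have d: "d g \<in> H" "g = t [^]\<^bsub>K\<^esub> e g \<otimes>\<^bsub>K\<^esub> d g"
          using e[OF that] by blast+
        have "?T \<otimes>\<^bsub>K\<^esub> g = t [^]\<^bsub>K\<^esub> (int M + e g) \<otimes>\<^bsub>K\<^esub> d g"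
          using tK HK[OF d(1)]
          by (subst d(2)) (simp add: K.m_assoc[symmetric] K.int_pow_mult int_pow_int)
        also have "int M + e g = int (nat (int M + e g))" using M[OF that] by simp
        finally have "?T \<otimes>\<^bsub>K\<^esub> g = ?p (nat (int M + e g)) (d g)" by (simp only: int_pow_int)
        moreover have "nat (int M + e g) \<le> 2 * M" using M[OF that] by simp
        ultimately show ?thesis using d(1) by blast
      qed
      moreover have "(\<lambda>h. ?T \<otimes>\<^bsub>K\<^esub> h) \<in> left_translations K H'" "(\<lambda>h. inv\<^bsub>K\<^esub> ?T \<otimes>\<^bsub>K\<^esub> h) \<in> left_translations K H'"
        using tn by (auto simp: left_translations_def)
      moreover have "\<forall>h\<in>H'. inv\<^bsub>K\<^esub> ?T \<otimes>\<^bsub>K\<^esub> (?T \<otimes>\<^bsub>K\<^esub> h) = h"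
        using tn' H'K by (simp add: K.m_assoc[symmetric])
      ultimately show ?thesis by blast
    qed
  qed auto
  show ?thesis using noetherian_if_coefficients_noetherian noeth by blast
qed

lemma cyclic_quotient_generator:
  assumes "group G" "subgroup H' G" "H \<lhd> G\<lparr>carrier := H'\<rparr>" "cyclic_group (G\<lparr>carrier := H'\<rparr> Mod H)"
  obtains t where "t \<in> H'"
    "\<And>h. h \<in> H \<Longrightarrow> t \<otimes>\<^bsub>G\<^esub> h \<otimes>\<^bsub>G\<^esub> inv\<^bsub>G\<^esub> t \<in> H"
    "\<And>h. h \<in> H \<Longrightarrow> inv\<^bsub>G\<^esub> t \<otimes>\<^bsub>G\<^esub> h \<otimes>\<^bsub>G\<^esub> t \<in> H"
    "\<And>g. g \<in> H' \<Longrightarrow> \<exists>n::int. \<exists>h\<in>H. g = t [^]\<^bsub>G\<^esub> n \<otimes>\<^bsub>G\<^esub> h"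
proof -
  interpret G: group G by fact
  interpret H': subgroup H' G by fact
  let ?L = "G\<lparr>carrier := H'\<rparr>"
  interpret N: normal H ?L by fact
  interpret Q: group "?L Mod H" by (rule N.factorgroup_is_group)
  obtain T where T: "T \<in> carrier (?L Mod H)" "carrier (?L Mod H) = range (\<lambda>n::int. T [^]\<^bsub>?L Mod H\<^esub> n)"
    using assms(4) Q.cyclic_group by blast
  then obtain t where t: "t \<in> H'" "T = H #>\<^bsub>?L\<^esub> t"
    by (auto simp: FactGroup_def RCOSETS_def)
  have inv: "inv\<^bsub>?L\<^esub> t = inv\<^bsub>G\<^esub> t" using G.m_inv_consistent[OF assms(2) t(1)] .
  show thesis
  proof (rule that[OF t(1)])
    show "t \<otimes>\<^bsub>G\<^esub> h \<otimes>\<^bsub>G\<^esub> inv\<^bsub>G\<^esub> t \<in> H" if "h \<in> H" for h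
      using N.inv_op_closed2[of t h] t(1) that inv by simp
    show "inv\<^bsub>G\<^esub> t \<otimes>\<^bsub>G\<^esub> h \<otimes>\<^bsub>G\<^esub> t \<in> H" if "h \<in> H" for h
      using N.inv_op_closed1[of t h] t(1) that inv by simp
    show "\<exists>n::int. \<exists>h\<in>H. g = t [^]\<^bsub>G\<^esub> n \<otimes>\<^bsub>G\<^esub> h" if g: "g \<in> H'" for g
    proof -
      have "H #>\<^bsub>?L\<^esub> g \<in> carrier (?L Mod H)" using g by (auto simp: FactGroup_def RCOSETS_def)
      then obtain n :: int where "H #>\<^bsub>?L\<^esub> g = T [^]\<^bsub>?L Mod H\<^esub> n" using T(2) by blast
      also have "\<dots> = H #>\<^bsub>?L\<^esub> (t [^]\<^bsub>?L\<^esub> n)" unfolding t(2) using N.FactGroup_int_pow[of t n] t(1) by simp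
      also have "\<dots> = (t [^]\<^bsub>?L\<^esub> n) <#\<^bsub>?L\<^esub> H"
        using N.coset_eq t(1) N.int_pow_closed[of t n] by simp
      also have "t [^]\<^bsub>?L\<^esub> n = t [^]\<^bsub>G\<^esub> n" using G.int_pow_consistent[OF assms(2) t(1), of n] by simp
      finally have "H #>\<^bsub>?L\<^esub> g = (t [^]\<^bsub>G\<^esub> n) <#\<^bsub>?L\<^esub> H" .
      moreover have "g \<in> H #>\<^bsub>?L\<^esub> g" using N.rcos_self[of g] g N.subgroup_axioms by simp
      ultimately show ?thesis by (auto simp: l_coset_def)
    qed
  qed
qed

text \<open>The subgroups that interpolate between \<open>G\<^sup>A\<close> and \<open>G\<close> to the power \<open>insert a A\<close>: the coordinate \<open>a\<close>
is confined to \<open>S\<close>, those in \<open>A\<close> are free and all others are trivial.\<close>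

definition slice :: "('g, 'b) monoid_scheme \<Rightarrow> 'x set \<Rightarrow> 'x set \<Rightarrow> 'x \<Rightarrow> 'g set \<Rightarrow> ('x \<Rightarrow> 'g) set" where
  "slice G x A a S = {\<rho> \<in> x \<rightarrow>\<^sub>E carrier G. \<rho> a \<in> S \<and> (\<forall>b\<in>x - insert a A. \<rho> b = \<one>\<^bsub>G\<^esub>)}"

lemma subgroup_slice:
  assumes "group G" "subgroup S G" "a \<in> x"
  shows "subgroup (slice G x A a S) (product_group x (\<lambda>_. G))"
proof -
  interpret G: group G by fact
  interpret S: subgroup S G by fact
  interpret K: group "product_group x (\<lambda>_. G)" using assms(1) by simp
  show ?thesis
  proof (rule K.subgroupI)
    show "slice G x A a S \<subseteq> carrier (product_group x (\<lambda>_. G))" by (auto simp: slice_def)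
    have "(\<lambda>b\<in>x. \<one>\<^bsub>G\<^esub>) \<in> slice G x A a S" using assms(3) by (auto simp: slice_def)
    then show "slice G x A a S \<noteq> {}" by blast
    show "inv\<^bsub>product_group x (\<lambda>_. G)\<^esub> \<rho> \<in> slice G x A a S" if "\<rho> \<in> slice G x A a S" for \<rho>
      using that assms by (auto simp: slice_def)
    show "\<rho> \<otimes>\<^bsub>product_group x (\<lambda>_. G)\<^esub> \<sigma> \<in> slice G x A a S"
      if "\<rho> \<in> slice G x A a S" "\<sigma> \<in> slice G x A a S" for \<rho> \<sigma>
      using that assms(3) by (auto simp: slice_def PiE_iff)
  qed
qed

text \<open>A generator of \<open>S'\<close> over \<open>S\<close>, put at the coordinate \<open>a\<close>, generates the larger slice over the smaller.\<close>

lemma noetherian_slice_cyclic: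
  fixes G :: "('g, 'b) monoid_scheme" and x :: "'x set"
  defines "K \<equiv> product_group x (\<lambda>_. G)"
  assumes "group G" "ring k" "subgroup S G" "subgroup S' G" "S \<subseteq> S'" "S \<lhd> G\<lparr>carrier := S'\<rparr>"
    and cyc: "cyclic_group (G\<lparr>carrier := S'\<rparr> Mod S)" and a: "a \<in> x"
    and noeth: "noetherian_set k (slice G x A a S) (left_translations K (slice G x A a S))"
  shows "noetherian_set k (slice G x A a S') (left_translations K (slice G x A a S'))"
proof -
  interpret G: group G by fact
  interpret S: subgroup S G by fact
  interpret S': subgroup S' G by fact
  interpret K: group K unfolding K_def using assms(2) by simp
  obtain t where t: "t \<in> S'" "\<And>h. h \<in> S \<Longrightarrow> t \<otimes>\<^bsub>G\<^esub> h \<otimes>\<^bsub>G\<^esub> inv\<^bsub>G\<^esub> t \<in> S"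
    "\<And>h. h \<in> S \<Longrightarrow> inv\<^bsub>G\<^esub> t \<otimes>\<^bsub>G\<^esub> h \<otimes>\<^bsub>G\<^esub> t \<in> S"
    "\<And>g. g \<in> S' \<Longrightarrow> \<exists>n::int. \<exists>h\<in>S. g = t [^]\<^bsub>G\<^esub> n \<otimes>\<^bsub>G\<^esub> h"
    using cyclic_quotient_generator[OF assms(2,5,7) cyc] by blast
  have tG: "t \<in> carrier G" using t(1) S'.subset by blast
  define u where "u = (\<lambda>b\<in>x. if b = a then t else \<one>\<^bsub>G\<^esub>)"
  have uE: "u \<in> x \<rightarrow>\<^sub>E carrier G" using tG by (auto simp: u_def)
  then have uK: "u \<in> carrier K" by (simp add: K_def)
  have mult: "(\<rho> \<otimes>\<^bsub>K\<^esub> \<sigma>) b = \<rho> b \<otimes>\<^bsub>G\<^esub> \<sigma> b" if "b \<in> x" for \<rho> \<sigma> b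
    using that by (simp add: K_def)
  have inv: "(inv\<^bsub>K\<^esub> \<rho>) b = inv\<^bsub>G\<^esub> \<rho> b" if "\<rho> \<in> carrier K" "b \<in> x" for \<rho> b
    using that assms(2) by (simp add: K_def)
  have pow: "(u [^]\<^bsub>K\<^esub> (n::int)) b = u b [^]\<^bsub>G\<^esub> n" if "b \<in> x" for n b
  proof -
    have "(\<lambda>\<rho>. \<rho> b) \<in> hom K G" using that by (auto simp: hom_def K_def PiE_iff)
    then show ?thesis using hom_int_pow[of "\<lambda>\<rho>. \<rho> b" K G u n] uK K.is_group G.is_group by simp
  qed
  have ua: "u a = t" and ub: "\<And>b. b \<in> x - insert a A \<Longrightarrow> u b = \<one>\<^bsub>G\<^esub>" using a by (auto simp: u_def)
  have slice_iff: "\<rho> \<in> slice G x A a T \<longleftrightarrow> \<rho> \<in> carrier K \<and> \<rho> a \<in> T \<and> (\<forall>b\<in>x - insert a A. \<rho> b = \<one>\<^bsub>G\<^esub>)" for \<rho> T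
    by (auto simp: slice_def K_def)
  show ?thesis
  proof (rule noetherian_cyclic_extension[OF K.is_group assms(3) _ _ _ _ _ _ _ noeth, of "slice G x A a S'" u])
    show "subgroup (slice G x A a S) K" "subgroup (slice G x A a S') K"
      unfolding K_def by (intro subgroup_slice assms a)+
    show "slice G x A a S \<subseteq> slice G x A a S'" using assms(6) by (auto simp: slice_def)
    show "u \<in> slice G x A a S'" using uK ua ub t(1) by (simp add: slice_iff)
    fix \<rho> assume \<rho>: "\<rho> \<in> slice G x A a S"
    then have "\<rho> \<in> carrier K" "\<rho> a \<in> S" by (auto simp: slice_iff)
    then show "u \<otimes>\<^bsub>K\<^esub> \<rho> \<otimes>\<^bsub>K\<^esub> inv\<^bsub>K\<^esub> u \<in> slice G x A a S" "inv\<^bsub>K\<^esub> u \<otimes>\<^bsub>K\<^esub> \<rho> \<otimes>\<^bsub>K\<^esub> u \<in> slice G x A a S"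
      using \<rho> t(2,3) uK ua ub a by (simp_all add: slice_iff mult inv)
  next
    fix \<rho> assume \<rho>: "\<rho> \<in> slice G x A a S'"
    then have \<rho>K: "\<rho> \<in> carrier K" by (simp add: slice_iff)
    from \<rho> obtain n :: int and h where h: "h \<in> S" "\<rho> a = t [^]\<^bsub>G\<^esub> n \<otimes>\<^bsub>G\<^esub> h"
      using t(4)[of "\<rho> a"] by (auto simp: slice_iff)
    let ?\<sigma> = "inv\<^bsub>K\<^esub> (u [^]\<^bsub>K\<^esub> n) \<otimes>\<^bsub>K\<^esub> \<rho>"
    have uK': "u [^]\<^bsub>K\<^esub> n \<in> carrier K" using uK by simp
    have "?\<sigma> a = inv\<^bsub>G\<^esub> (t [^]\<^bsub>G\<^esub> n) \<otimes>\<^bsub>G\<^esub> (t [^]\<^bsub>G\<^esub> n \<otimes>\<^bsub>G\<^esub> h)"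
      using h(2) uK' a ua by (simp add: mult inv pow)
    also have "\<dots> = h" using tG h(1) S.subset by (simp add: G.m_assoc[symmetric] subset_iff)
    finally have "?\<sigma> \<in> slice G x A a S"
      using \<rho> \<rho>K uK' h(1) ub by (simp add: slice_iff mult inv pow)
    moreover have "\<rho> = u [^]\<^bsub>K\<^esub> n \<otimes>\<^bsub>K\<^esub> ?\<sigma>"
      using \<rho>K uK' by (simp add: K.m_assoc[symmetric])
    ultimately show "\<exists>n::int. \<exists>h\<in>slice G x A a S. \<rho> = u [^]\<^bsub>K\<^esub> n \<otimes>\<^bsub>K\<^esub> h" by blast
  qed
qed

lemma noetherian_slice_finite_index:
  fixes G :: "('g, 'b) monoid_scheme" and x :: "'x set"
  defines "K \<equiv> product_group x (\<lambda>_. G)"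
  assumes "group G" "ring k" "subgroup S G" "finite (rcosets\<^bsub>G\<^esub> S)" and a: "a \<in> x"
    and noeth: "noetherian_set k (slice G x A a S) (left_translations K (slice G x A a S))"
  shows "noetherian_set k (slice G x A a (carrier G)) (left_translations K (slice G x A a (carrier G)))"
proof -
  interpret G: group G by fact
  interpret S: subgroup S G by fact
  interpret K: group K unfolding K_def using assms(2) by simp
  have "rcosets\<^bsub>G\<^esub> S = (\<lambda>c. S #>\<^bsub>G\<^esub> c) ` carrier G" by (auto simp: RCOSETS_def)
  then obtain C where C: "finite C" "C \<subseteq> carrier G" "rcosets\<^bsub>G\<^esub> S = (\<lambda>c. S #>\<^bsub>G\<^esub> c) ` C"
    using finite_subset_image[of "rcosets\<^bsub>G\<^esub> S" "\<lambda>c. S #>\<^bsub>G\<^esub> c" "carrier G"] assms(5) by auto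
  define u where "u c = (\<lambda>b\<in>x. if b = a then c else \<one>\<^bsub>G\<^esub>)" for c
  have mult: "(\<rho> \<otimes>\<^bsub>K\<^esub> \<sigma>) b = \<rho> b \<otimes>\<^bsub>G\<^esub> \<sigma> b" if "b \<in> x" for \<rho> \<sigma> b
    using that by (simp add: K_def)
  have inv: "(inv\<^bsub>K\<^esub> \<rho>) b = inv\<^bsub>G\<^esub> \<rho> b" if "\<rho> \<in> carrier K" "b \<in> x" for \<rho> b
    using that assms(2) by (simp add: K_def)
  have slice_iff: "\<rho> \<in> slice G x A a T \<longleftrightarrow> \<rho> \<in> carrier K \<and> \<rho> a \<in> T \<and> (\<forall>b\<in>x - insert a A. \<rho> b = \<one>\<^bsub>G\<^esub>)" for \<rho> T
    by (auto simp: slice_def K_def)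
  have u: "u c \<in> slice G x A a (carrier G)" if "c \<in> carrier G" for c
    using that a by (auto simp: slice_iff u_def K_def)
  have ua: "u c a = c" and ub: "\<And>b. b \<in> x - insert a A \<Longrightarrow> u c b = \<one>\<^bsub>G\<^esub>" for c using a by (auto simp: u_def)
  have sub: "subgroup (slice G x A a S) K" "subgroup (slice G x A a (carrier G)) K"
    unfolding K_def by (intro subgroup_slice assms a G.subgroup_self)+
  have le: "slice G x A a S \<subseteq> slice G x A a (carrier G)" using S.subset by (auto simp: slice_def)
  show ?thesis
  proof (rule noetherian_finite_index[OF K.is_group assms(3) sub le _ _ _ noeth, of "u ` C"])
    show "finite (u ` C)" "u ` C \<subseteq> slice G x A a (carrier G)" using C u by auto
    show "slice G x A a (carrier G) = (\<Union>c\<in>u ` C. (\<lambda>h. h \<otimes>\<^bsub>K\<^esub> c) ` slice G x A a S)" (is "_ = ?r")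
    proof (intro equalityI subsetI)
      fix \<rho> assume "\<rho> \<in> ?r"
      then obtain c \<sigma> where "c \<in> C" "\<sigma> \<in> slice G x A a S" "\<rho> = \<sigma> \<otimes>\<^bsub>K\<^esub> u c" by blast
      then show "\<rho> \<in> slice G x A a (carrier G)"
        using subgroup.m_closed[OF sub(2)] le u C(2) by blast
    next
      fix \<rho> assume \<rho>: "\<rho> \<in> slice G x A a (carrier G)"
      then have \<rho>K: "\<rho> \<in> carrier K" and "\<rho> a \<in> carrier G" by (simp_all add: slice_iff)
      then have "S #>\<^bsub>G\<^esub> \<rho> a \<in> rcosets\<^bsub>G\<^esub> S" "\<rho> a \<in> S #>\<^bsub>G\<^esub> \<rho> a"
        using G.rcos_self S.subgroup_axioms by (auto simp: RCOSETS_def)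
      then obtain c where "c \<in> C" "\<rho> a \<in> S #>\<^bsub>G\<^esub> c" unfolding C(3) by blast
      then obtain h where c: "c \<in> C" "h \<in> S" "\<rho> a = h \<otimes>\<^bsub>G\<^esub> c"
        unfolding r_coset_def by blast
      have cG: "c \<in> carrier G" "h \<in> carrier G" using c C(2) S.subset by auto
      have uc: "u c \<in> carrier K" using u[OF cG(1)] by (simp add: slice_iff)
      let ?\<sigma> = "\<rho> \<otimes>\<^bsub>K\<^esub> inv\<^bsub>K\<^esub> (u c)"
      have "?\<sigma> a = h" using c(3) a uc ua cG by (simp add: mult inv G.m_assoc)
      then have "?\<sigma> \<in> slice G x A a S"
        using \<rho> uc \<rho>K c(2) ub by (simp add: slice_iff mult inv)
      moreover have "\<rho> = ?\<sigma> \<otimes>\<^bsub>K\<^esub> u c" using \<rho>K uc by (simp add: K.m_assoc)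
      ultimately show "\<rho> \<in> ?r" using c(1) by blast
    qed
  qed
qed

text \<open>P. Hall's theorem for powers of \<open>G\<close>. No subnormal series of the power is written down: the coordinates
are freed one after the other, each by climbing the series of \<open>G\<close>.\<close>

theorem noetherian_power_polycyclic_by_finite:
  fixes G :: "('g, 'b) monoid_scheme" and x :: "'x set"
  assumes "group G" "polycyclic_by_finite G" "left_noetherian k" "finite x"
  shows "noetherian_set k (x \<rightarrow>\<^sub>E carrier G) (left_translations (product_group x (\<lambda>_. G)) (x \<rightarrow>\<^sub>E carrier G))"
proof -
  interpret G: group G by fact
  let ?K = "product_group x (\<lambda>_. G)"
  have k: "ring k" using assms(3) by (simp add: left_noetherian_def)
  obtain P where P: "subgroup P G" "finite (rcosets\<^bsub>G\<^esub> P)" "polycyclic (G\<lparr>carrier := P\<rparr>)"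
    using assms(2) unfolding polycyclic_by_finite_def by blast
  let ?L = "G\<lparr>carrier := P\<rparr>"
  obtain r and H :: "nat \<Rightarrow> 'g set" where H: "H 0 = {\<one>\<^bsub>G\<^esub>}" "H r = P"
    "\<And>i. i \<le> r \<Longrightarrow> subgroup (H i) ?L" "\<And>i. i < r \<Longrightarrow> H i \<subseteq> H (Suc i)"
    "\<And>i. i < r \<Longrightarrow> H i \<lhd> G\<lparr>carrier := H (Suc i)\<rparr>"
    "\<And>i. i < r \<Longrightarrow> cyclic_group (G\<lparr>carrier := H (Suc i)\<rparr> Mod H i)"
    using P(3) unfolding polycyclic_def by auto
  have HG: "subgroup (H i) G" if "i \<le> r" for i using G.incl_subgroup[OF P(1) H(3)[OF that]] .
  define W where "W A = {\<rho> \<in> x \<rightarrow>\<^sub>E carrier G. \<forall>b\<in>x - A. \<rho> b = \<one>\<^bsub>G\<^esub>}" for A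
  have "noetherian_set k (W A) (left_translations ?K (W A))" if "A \<subseteq> x" for A
    using finite_subset[OF that assms(4)] that
  proof (induction A rule: finite_induct)
    case empty
    have "W {} = {\<one>\<^bsub>?K\<^esub>}" by (auto simp: W_def fun_eq_iff PiE_iff extensional_def)
    then show ?case using noetherian_trivial_group[of ?K k] assms(1,3) by simp
  next
    case (insert a A)
    have a: "a \<in> x" "a \<notin> A" using insert by auto
    have bottom: "slice G x A a {\<one>\<^bsub>G\<^esub>} = W A" using a by (auto simp: slice_def W_def)
    have top: "slice G x A a (carrier G) = W (insert a A)" using a by (auto simp: slice_def W_def)
    let ?noeth = "\<lambda>S. noetherian_set k (slice G x A a S) (left_translations ?K (slice G x A a S))"
    have "?noeth (H i)" if "i \<le> r" for i
      using that
    proof (induction i)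
      case 0
      then show ?case using insert by (simp add: H(1) bottom)
    next
      case (Suc i)
      then have i: "i < r" "i \<le> r" by auto
      show ?case
        by (rule noetherian_slice_cyclic[OF assms(1) k HG[OF i(2)] HG[OF Suc.prems] H(4-6)[OF i(1)] a(1)])
          (use Suc i in blast)
    qed
    then have "?noeth P" using H(2) by blast
    then have "?noeth (carrier G)" by (rule noetherian_slice_finite_index[OF assms(1) k P(1,2) a(1)])
    then show ?case by (simp add: top)
  qed
  moreover have "W x = x \<rightarrow>\<^sub>E carrier G" by (auto simp: W_def)
  ultimately show ?thesis by (metis order_refl)
qed

section \<open>Representations as linearised diagrams\<close>

text \<open>The set-valued functor whose linearisation is the sum of the principal projectives at
\<open>src 0, ..., src (n - 1)\<close>, on objects and on morphisms; \<open>flatten\<close> is the isomorphism from the sum.\<close>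

definition sum_basis :: "('o, 'm) category \<Rightarrow> nat \<Rightarrow> (nat \<Rightarrow> 'o) \<Rightarrow> 'o \<Rightarrow> (nat \<times> 'm) set" where
  "sum_basis C n src y = Sigma {..<n} (\<lambda>i. Hom C (src i) y)"

definition sum_action ::
  "('o, 'm) category \<Rightarrow> (nat \<Rightarrow> 'o) \<Rightarrow> 'o \<Rightarrow> 'o \<Rightarrow> 'm \<Rightarrow> nat \<times> 'm \<Rightarrow> nat \<times> 'm" where
  "sum_action C src y y' \<phi> = (\<lambda>(i, h). (i, Comp C (src i) y y' \<phi> h))"

definition flatten :: "('r, 'c) ring_scheme \<Rightarrow> nat \<Rightarrow> (nat \<Rightarrow> 'm \<Rightarrow> 'r) \<Rightarrow> nat \<times> 'm \<Rightarrow> 'r" where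
  "flatten R n u = (\<lambda>(i, h). if i < n then u i h else \<zero>\<^bsub>R\<^esub>)"

lemma principal_sum_simps:
  fixes C :: "('o, 'm) category" and R :: "('r, 'c) ring_scheme"
  defines "P \<equiv> \<lambda>src n. finite_direct_sum {..<n::nat} (\<lambda>i. principal_projective C R (src i))"
  shows "carrier (Val (P src n) y) = (\<Pi>\<^sub>E i\<in>{..<n}. carrier (free_module R (Hom C (src i) y)))"
    "\<zero>\<^bsub>Val (P src n) y\<^esub> = (\<lambda>i\<in>{..<n}. \<lambda>h. \<zero>\<^bsub>R\<^esub>)"
    "u \<oplus>\<^bsub>Val (P src n) y\<^esub> v = (\<lambda>i\<in>{..<n}. \<lambda>h. u i h \<oplus>\<^bsub>R\<^esub> v i h)"
    "c \<odot>\<^bsub>Val (P src n) y\<^esub> u = (\<lambda>i\<in>{..<n}. \<lambda>h. c \<otimes>\<^bsub>R\<^esub> u i h)"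
    "Act (P src n) y z \<phi> u = (\<lambda>i\<in>{..<n}. \<lambda>h.
      finsum R (u i) {g \<in> Hom C (src i) y. u i g \<noteq> \<zero>\<^bsub>R\<^esub> \<and> Comp C (src i) y z \<phi> g = h})"
  by (simp_all add: P_def finite_direct_sum_def principal_projective_def free_module_def)

text \<open>Where postcomposition is injective, the sum over a fibre that defines the action on a principal
projective has at most one term.\<close>

lemma push_flatten:
  fixes C :: "('o, 'm) category" and R :: "('r, 'c) ring_scheme"
  defines "P \<equiv> \<lambda>src n. finite_direct_sum {..<n::nat} (\<lambda>i. principal_projective C R (src i))"
  assumes "ring R"
    and inj: "\<And>i. i < n \<Longrightarrow> inj_on (Comp C (src i) y z \<phi>) (Hom C (src i) y)"
    and u: "u \<in> carrier (Val (P src n) y)"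
  shows "push R (sum_basis C n src y) (sum_action C src y z \<phi>) (flatten R n u) = flatten R n (Act (P src n) y z \<phi> u)"
proof (rule push_eqI)
  interpret ring R by fact
  have uc: "u i h \<in> carrier R" if "i < n" for i h
    using u that by (auto simp: P_def principal_sum_simps PiE_iff free_module_def)
  show "inj_on (sum_action C src y z \<phi>) (sum_basis C n src y)"
    using inj by (auto simp: inj_on_def sum_action_def sum_basis_def)
  show "flatten R n (Act (P src n) y z \<phi> u) (sum_action C src y z \<phi> b) = flatten R n u b"
    if b: "b \<in> sum_basis C n src y" for b
  proof -
    obtain i h where ih: "b = (i, h)" "i < n" "h \<in> Hom C (src i) y" using b by (auto simp: sum_basis_def)
    have "{g \<in> Hom C (src i) y. u i g \<noteq> \<zero>\<^bsub>R\<^esub> \<and> Comp C (src i) y z \<phi> g = Comp C (src i) y z \<phi> h}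
        = (if u i h = \<zero>\<^bsub>R\<^esub> then {} else {h})"
      using inj_onD[OF inj[OF ih(2)] _ _ ih(3)] ih(3) by auto
    then show ?thesis
      using ih uc[OF ih(2)] by (simp add: flatten_def sum_action_def P_def principal_sum_simps)
  qed
  show "flatten R n (Act (P src n) y z \<phi> u) d = \<zero>\<^bsub>R\<^esub>"
    if d: "d \<notin> sum_action C src y z \<phi> ` sum_basis C n src y" for d
  proof (cases "fst d < n")
    case True
    obtain i h where ih: "d = (i, h)" by (cases d)
    then have "i < n" using True by simp
    then have "h \<notin> Comp C (src i) y z \<phi> ` Hom C (src i) y"
      using d unfolding ih by (force simp: sum_action_def sum_basis_def image_iff)
    then have e: "{g \<in> Hom C (src i) y. u i g \<noteq> \<zero>\<^bsub>R\<^esub> \<and> Comp C (src i) y z \<phi> g = h} = {}" by blast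
    show ?thesis
      unfolding ih P_def flatten_def principal_sum_simps using \<open>i < n\<close>
      by (simp only: prod.case if_True restrict_apply lessThan_iff e finsum_empty)
  qed (auto simp: flatten_def split: prod.splits)
qed

text \<open>A chain of subrepresentations of a quotient of such a sum is determined by its preimages in the sum.\<close>

lemma Rep_noetherian_if_noetherian_diagrams:
  fixes C :: "('o, 'm) category" and R :: "('r, 'c) ring_scheme"
  assumes C: "category C" and R: "ring R"
    and monic: "\<And>x y z \<phi>. x \<in> Obj C \<Longrightarrow> y \<in> Obj C \<Longrightarrow> z \<in> Obj C \<Longrightarrow> \<phi> \<in> Hom C y z \<Longrightarrow>
      inj_on (Comp C x y z \<phi>) (Hom C x y)"
    and noeth: "\<And>n src. (\<And>i. i < n \<Longrightarrow> src i \<in> Obj C) \<Longrightarrow>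
      noetherian_diagram R (Obj C) (sum_basis C n src) (\<lambda>y z. sum_action C src y z ` Hom C y z)"
  shows "Rep_noetherian C R TYPE('v)"
  unfolding Rep_noetherian_def
proof (intro allI impI)
  fix M :: "('o, 'm, 'r, 'v) rep"
  assume M: "fin_gen_rep C R M"
  then have rep: "representation C R M" by (simp add: fin_gen_rep_def)
  obtain n :: nat and src where src: "\<And>i. i < n \<Longrightarrow> src i \<in> Obj C"
    and quot: "rep_quotient C R (finite_direct_sum {..<n} (\<lambda>i. principal_projective C R (src i))) M"
    using M unfolding fin_gen_rep_def by blast
  let ?P = "finite_direct_sum {..<n} (\<lambda>i. principal_projective C R (src i))"
  obtain \<eta> where \<eta>: "\<eta> \<in> rep_hom C R ?P M" "\<And>y. y \<in> Obj C \<Longrightarrow> \<eta> y ` carrier (Val ?P y) = carrier (Val M y)"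
    using quot unfolding rep_quotient_def by blast
  have hom: "\<eta> y \<in> left_module_hom R (Val ?P y) (Val M y)" if "y \<in> Obj C" for y
    using \<eta>(1) that by (simp add: rep_hom_def)
  have nat: "\<eta> z (Act ?P y z \<phi> u) = Act M y z \<phi> (\<eta> y u)"
    if "y \<in> Obj C" "z \<in> Obj C" "\<phi> \<in> Hom C y z" "u \<in> carrier (Val ?P y)" for y z \<phi> u
    using \<eta>(1) that by (simp add: rep_hom_def)
  have repP: "representation C R ?P"
    using representation_principal_projective[OF C R src] by (intro representation_finite_direct_sum C R) simp
  note simps = principal_sum_simps
  interpret R: ring R by (rule R)
  show "noetherian_rep C R M"
    unfolding noetherian_rep_def
  proof (intro conjI allI impI rep, elim conjE)
    fix N :: "nat \<Rightarrow> 'o \<Rightarrow> 'v set"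
    assume st: "\<forall>j. subrepresentation C R (N j) M"
      and inc: "\<forall>j. \<forall>x\<in>Obj C. N j x \<subseteq> N (Suc j) x"
    define F where "F j y = flatten R n ` {u \<in> carrier (Val ?P y). \<eta> y u \<in> N j y}" for j y
    have stF: "stable_family R (Obj C) (sum_basis C n src) (\<lambda>y z. sum_action C src y z ` Hom C y z) (F j)" for j
      unfolding stable_family_def submodule_free_module_iff[OF R]
    proof (intro conjI ballI)
      fix y assume y: "y \<in> Obj C"
      interpret N: submodule "N j y" R "Val M y" using st y by (simp add: subrepresentation_def)
      interpret M: left_module R "Val M y" using rep y by (simp add: representation_def)
      interpret P: left_module R "Val ?P y" using repP y by (simp add: representation_def)
      have add: "\<eta> y (u \<oplus>\<^bsub>Val ?P y\<^esub> v) = \<eta> y u \<oplus>\<^bsub>Val M y\<^esub> \<eta> y v"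
        if "u \<in> carrier (Val ?P y)" "v \<in> carrier (Val ?P y)" for u v
        using hom[OF y] that by (simp add: left_module_hom_def)
      have smult: "\<eta> y (c \<odot>\<^bsub>Val ?P y\<^esub> u) = c \<odot>\<^bsub>Val M y\<^esub> \<eta> y u"
        if "u \<in> carrier (Val ?P y)" "c \<in> carrier R" for u c
        using hom[OF y] that by (simp add: left_module_hom_def)
      have clos: "\<eta> y u \<in> carrier (Val M y)" if "u \<in> carrier (Val ?P y)" for u
        using hom[OF y] that by (auto simp: left_module_hom_def)
      have "\<eta> y \<zero>\<^bsub>Val ?P y\<^esub> \<oplus>\<^bsub>Val M y\<^esub> \<eta> y \<zero>\<^bsub>Val ?P y\<^esub> = \<eta> y \<zero>\<^bsub>Val ?P y\<^esub> \<oplus>\<^bsub>Val M y\<^esub> \<zero>\<^bsub>Val M y\<^esub>"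
        using add[of "\<zero>\<^bsub>Val ?P y\<^esub>" "\<zero>\<^bsub>Val ?P y\<^esub>"] clos by simp
      then have zero: "\<eta> y \<zero>\<^bsub>Val ?P y\<^esub> = \<zero>\<^bsub>Val M y\<^esub>" using clos by (simp only: M.add.l_cancel P.zero_closed M.zero_closed)
      show "F j y \<subseteq> carrier (free_module R (sum_basis C n src y))"
      proof
        fix a assume "a \<in> F j y"
        then obtain u where u: "u \<in> carrier (Val ?P y)" "a = flatten R n u" by (auto simp: F_def)
        have ui: "u i \<in> carrier (free_module R (Hom C (src i) y))" if "i < n" for i
          using u(1) that by (auto simp: simps)
        have uh: "u i h \<in> carrier R" "u i h \<noteq> \<zero>\<^bsub>R\<^esub> \<Longrightarrow> h \<in> Hom C (src i) y" if "i < n" for i h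
          using ui[OF that] by (auto simp: free_module_def)
        have "{b. a b \<noteq> \<zero>\<^bsub>R\<^esub>} \<subseteq> Sigma {..<n} (\<lambda>i. {h. u i h \<noteq> \<zero>\<^bsub>R\<^esub>})"
          unfolding u(2) by (auto simp: flatten_def split: if_splits)
        moreover have "finite (Sigma {..<n} (\<lambda>i. {h. u i h \<noteq> \<zero>\<^bsub>R\<^esub>}))"
          using ui by (auto simp: free_module_def)
        ultimately have "finite {b. a b \<noteq> \<zero>\<^bsub>R\<^esub>}" by (rule finite_subset)
        then show "a \<in> carrier (free_module R (sum_basis C n src y))"
          using uh unfolding u(2) by (auto simp: free_module_def flatten_def sum_basis_def split: if_splits)
      qed
      show "(\<lambda>b. \<zero>\<^bsub>R\<^esub>) \<in> F j y"
      proof -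
        have "(\<lambda>b. \<zero>\<^bsub>R\<^esub>) = flatten R n \<zero>\<^bsub>Val ?P y\<^esub>" by (auto simp: flatten_def simps fun_eq_iff)
        then show ?thesis unfolding F_def using zero N.one_closed by (intro image_eqI[of _ _ "\<zero>\<^bsub>Val ?P y\<^esub>"]) auto
      qed
      fix a assume "a \<in> F j y"
      then obtain u where u: "u \<in> carrier (Val ?P y)" "\<eta> y u \<in> N j y" "a = flatten R n u" by (auto simp: F_def)
      show "(\<lambda>h. c \<otimes>\<^bsub>R\<^esub> a h) \<in> F j y" if c: "c \<in> carrier R" for c
      proof -
        have "(\<lambda>h. c \<otimes>\<^bsub>R\<^esub> a h) = flatten R n (c \<odot>\<^bsub>Val ?P y\<^esub> u)"
          using c by (auto simp: flatten_def simps fun_eq_iff u(3))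
        then show ?thesis unfolding F_def
          using smult[OF u(1) c] N.smult_closed[OF c u(2)] P.smult_closed[OF c u(1)]
          by (intro image_eqI[of _ _ "c \<odot>\<^bsub>Val ?P y\<^esub> u"]) auto
      qed
      fix b assume "b \<in> F j y"
      then obtain v where v: "v \<in> carrier (Val ?P y)" "\<eta> y v \<in> N j y" "b = flatten R n v" by (auto simp: F_def)
      have "(\<lambda>h. a h \<oplus>\<^bsub>R\<^esub> b h) = flatten R n (u \<oplus>\<^bsub>Val ?P y\<^esub> v)"
        by (auto simp: flatten_def simps fun_eq_iff u(3) v(3))
      then show "(\<lambda>h. a h \<oplus>\<^bsub>R\<^esub> b h) \<in> F j y" unfolding F_def
        using add[OF u(1) v(1)] N.m_closed[OF u(2) v(2)] P.a_closed[OF u(1) v(1)]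
        by (intro image_eqI[of _ _ "u \<oplus>\<^bsub>Val ?P y\<^esub> v"]) auto
    next
      fix y z \<mu> a assume y: "y \<in> Obj C" and z: "z \<in> Obj C" and "\<mu> \<in> sum_action C src y z ` Hom C y z" "a \<in> F j y"
      then obtain \<phi> u where \<phi>: "\<phi> \<in> Hom C y z" "\<mu> = sum_action C src y z \<phi>"
        and u: "u \<in> carrier (Val ?P y)" "\<eta> y u \<in> N j y" "a = flatten R n u" by (auto simp: F_def)
      have 1: "push R (sum_basis C n src y) \<mu> a = flatten R n (Act ?P y z \<phi> u)"
        unfolding \<phi>(2) u(3) by (rule push_flatten[OF R monic[OF src y z \<phi>(1)] u(1)])
      have "Act ?P y z \<phi> \<in> left_module_hom R (Val ?P y) (Val ?P z)"
        using repP y z \<phi>(1) unfolding representation_def by blast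
      then have 2: "Act ?P y z \<phi> u \<in> carrier (Val ?P z)"
        using u(1) unfolding left_module_hom_def by blast
      have 3: "\<eta> z (Act ?P y z \<phi> u) \<in> N j z"
        using st y z \<phi>(1) u unfolding nat[OF y z \<phi>(1) u(1)] subrepresentation_def by blast
      show "push R (sum_basis C n src y) \<mu> a \<in> F j z" unfolding 1 F_def using 2 3 by blast
    qed
    have incF: "F j y \<subseteq> F (Suc j) y" if "y \<in> Obj C" for j y
      using inc that unfolding F_def by blast
    have "noetherian_diagram R (Obj C) (sum_basis C n src) (\<lambda>y z. sum_action C src y z ` Hom C y z)"
      by (rule noeth[of n src]) (rule src)
    then have "\<exists>n0. \<forall>j\<ge>n0. \<forall>y\<in>Obj C. F j y = F n0 y"
      unfolding noetherian_diagram_def using stF incF by blast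
    then obtain n0 where n0: "\<And>j y. j \<ge> n0 \<Longrightarrow> y \<in> Obj C \<Longrightarrow> F j y = F n0 y" by blast
    have half: "N i y \<subseteq> N j y" if y: "y \<in> Obj C" and F: "F i y = F j y" for i j y
    proof
      fix v assume v: "v \<in> N i y"
      have "submodule (N i y) R (Val M y)" using st y by (simp add: subrepresentation_def)
      then have "v \<in> carrier (Val M y)"
        using v submodule.axioms(1) subgroup.subset by fastforce
      then obtain u where u: "u \<in> carrier (Val ?P y)" "v = \<eta> y u" using \<eta>(2)[OF y] by blast
      then have "flatten R n u \<in> F i y" unfolding F_def using v by (intro imageI) simp
      then have "flatten R n u \<in> F j y" by (simp only: F)
      then obtain w where w: "w \<in> carrier (Val ?P y)" "\<eta> y w \<in> N j y" "flatten R n u = flatten R n w"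
        by (auto simp: F_def)
      have "u = w"
      proof (rule PiE_ext)
        show "u \<in> (\<Pi>\<^sub>E i\<in>{..<n}. carrier (free_module R (Hom C (src i) y)))"
          "w \<in> (\<Pi>\<^sub>E i\<in>{..<n}. carrier (free_module R (Hom C (src i) y)))"
          using u(1) w(1) by (simp_all add: simps)
        fix i assume "i \<in> {..<n}"
        then show "u i = w i"
          using fun_cong[OF w(3), of "(i, h)" for h] by (auto simp: flatten_def fun_eq_iff)
      qed
      then show "v \<in> N j y" using u(2) w(2) by simp
    qed
    show "\<exists>n0. \<forall>j\<ge>n0. \<forall>x\<in>Obj C. N j x = N n0 x"
    proof (intro exI[of _ n0] allI impI ballI equalityI)
      fix j x assume j: "n0 \<le> j" and x: "x \<in> Obj C"
      show "N j x \<subseteq> N n0 x" by (rule half[OF x n0[OF j x]])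
      show "N n0 x \<subseteq> N j x" by (rule half[OF x n0[OF j x, symmetric]])
    qed
  qed
qed

section \<open>The category of finite sets and injections with group labels\<close>

lemma FI_simps:
  "Obj (FI G) = {S. finite S}"
  "(f, \<rho>) \<in> Hom (FI G) S T \<longleftrightarrow> f \<in> S \<rightarrow>\<^sub>E T \<and> \<rho> \<in> S \<rightarrow>\<^sub>E carrier G \<and> inj_on f S"
  "Comp (FI G) S T U (g, \<sigma>) (f, \<rho>) = (compose S g f, \<lambda>a\<in>S. \<sigma> (f a) \<otimes>\<^bsub>G\<^esub> \<rho> a)"
  by (auto simp: FI_def G_maps_def G_map_comp_def)

lemma FI_monic:
  assumes "group G" "\<phi> \<in> Hom (FI G) T U"
  shows "inj_on (Comp (FI G) S T U \<phi>) (Hom (FI G) S T)"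
proof (rule inj_onI)
  interpret group G by fact
  fix h h' assume h: "h \<in> Hom (FI G) S T" "h' \<in> Hom (FI G) S T"
    and eq: "Comp (FI G) S T U \<phi> h = Comp (FI G) S T U \<phi> h'"
  obtain g \<sigma> f \<rho> f' \<rho>' where c: "\<phi> = (g, \<sigma>)" "h = (f, \<rho>)" "h' = (f', \<rho>')" by (metis surj_pair)
  have g: "g \<in> T \<rightarrow>\<^sub>E U" "\<sigma> \<in> T \<rightarrow>\<^sub>E carrier G" "inj_on g T"
    and f: "f \<in> S \<rightarrow>\<^sub>E T" "\<rho> \<in> S \<rightarrow>\<^sub>E carrier G" and f': "f' \<in> S \<rightarrow>\<^sub>E T" "\<rho>' \<in> S \<rightarrow>\<^sub>E carrier G"
    using assms(2) h unfolding c FI_simps by auto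
  have e: "compose S g f = compose S g f'" "(\<lambda>a\<in>S. \<sigma> (f a) \<otimes>\<^bsub>G\<^esub> \<rho> a) = (\<lambda>a\<in>S. \<sigma> (f' a) \<otimes>\<^bsub>G\<^esub> \<rho>' a)"
    using eq unfolding c FI_simps by auto
  have ff: "f = f'"
  proof (rule PiE_ext[OF f(1) f'(1)])
    fix a assume a: "a \<in> S"
    then have "g (f a) = g (f' a)" using fun_cong[OF e(1), of a] by (simp add: compose_def)
    then show "f a = f' a" using inj_onD[OF g(3)] PiE_mem[OF f(1) a] PiE_mem[OF f'(1) a] by blast
  qed
  have "\<rho> = \<rho>'"
  proof (rule PiE_ext[OF f(2) f'(2)])
    fix a assume a: "a \<in> S"
    then have "\<sigma> (f a) \<otimes>\<^bsub>G\<^esub> \<rho> a = \<sigma> (f a) \<otimes>\<^bsub>G\<^esub> \<rho>' a" using fun_cong[OF e(2), of a] ff by simp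
    moreover have "\<sigma> (f a) \<in> carrier G" using PiE_mem[OF g(2) PiE_mem[OF f(1) a]] .
    ultimately show "\<rho> a = \<rho>' a" using PiE_mem[OF f(2) a] PiE_mem[OF f'(2) a] by simp
  qed
  then show "h = h'" using ff c by simp
qed

text \<open>The objects \<open>box m\<close> play the role of the numbers below \<open>m\<close>; every object is isomorphic to one of
them. Among them, \<open>(i, f, m)\<close> is below \<open>(i, f', m')\<close> if an increasing map \<open>box m \<rightarrow> box m'\<close> carries \<open>f\<close>
to \<open>f'\<close>. Elements of a stable family can be translated by \<open>G\<close> at the points of the image of an injection
\<open>f\<close> alone. This moves the coefficient of \<open>f\<close> by an arbitrary element of the power of \<open>G\<close>, and it
changes the other coefficients but not which of them vanish.\<close>

lemma noetherian_FI_diagram: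
  fixes G :: "('g, 'b) monoid_scheme" and k :: "('r, 'c) ring_scheme"
    and src :: "nat \<Rightarrow> 'x::infinite set"
  assumes G: "group G" "polycyclic_by_finite G" and k: "left_noetherian k"
    and src: "\<And>i. i < n \<Longrightarrow> finite (src i)"
  shows "noetherian_diagram k (Obj (FI G)) (sum_basis (FI G) n src)
    (\<lambda>y z. sum_action (FI G) src y z ` Hom (FI G) y z)"
proof -
  interpret G: group G by fact
  have ring: "ring k" using k by (simp add: left_noetherian_def)
  obtain \<iota> :: "nat \<Rightarrow> 'x" where \<iota>: "inj \<iota>"
    using infinite_countable_subset[OF infinite_UNIV] by blast
  define \<kappa> where "\<kappa> = inv_into UNIV \<iota>"
  have \<kappa>[simp]: "\<kappa> (\<iota> j) = j" for j using \<iota> by (simp add: \<kappa>_def)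
  define box where "box m = \<iota> ` {..<m}" for m
  have \<iota>\<kappa>: "\<iota> (\<kappa> b) = b" "\<kappa> b < m" if "b \<in> box m" for b m using that by (auto simp: box_def)
  have box: "finite (box m)" for m by (simp add: box_def)
  have "\<exists>xs. set xs = src i" if "i < n" for i using finite_list[OF src[OF that]] .
  then obtain xs where xs: "\<And>i. i < n \<Longrightarrow> set (xs i) = src i" by metis
  define code where "code i f = map (\<lambda>a. \<kappa> (f a)) (xs i)" for i and f :: "'x \<Rightarrow> 'x"
  define label where "label i f = i # code i f" for i f
  have label_inj: "i = j \<and> f = g"
    if "label i f = label j g" "i < n" "f \<in> src i \<rightarrow>\<^sub>E box m" "g \<in> src j \<rightarrow>\<^sub>E box m" for i j f g m
  proof -
    have ij: "i = j" and c: "code i f = code i g" using that(1) by (auto simp: label_def)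
    have "f = g"
    proof (rule PiE_ext[OF that(3) that(4)[folded ij]])
      fix a assume a: "a \<in> src i"
      then have "\<kappa> (f a) = \<kappa> (g a)" using c xs[OF that(2)] by (auto simp: code_def)
      then show "f a = g a"
        using \<iota>\<kappa>(1)[OF PiE_mem[OF that(3) a]] \<iota>\<kappa>(1)[OF PiE_mem[OF that(4)[folded ij] a]] by metis
    qed
    then show ?thesis using ij by simp
  qed
  let ?B = "sum_basis (FI G) n src"
  let ?Mor = "\<lambda>y z. sum_action (FI G) src y z ` Hom (FI G) y z"
  let ?K = "\<lambda>i. product_group (src i) (\<lambda>_. G)"
  define Q where "Q = {(i, f, m). i < n \<and> f \<in> src i \<rightarrow>\<^sub>E box m \<and> inj_on f (src i)}"
  define ob where "ob = (\<lambda>(i::nat, f::'x \<Rightarrow> 'x, m). box m)"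
  define coef where "coef = (\<lambda>(i, f::'x \<Rightarrow> 'x, m::nat). src i \<rightarrow>\<^sub>E carrier G)"
  define T where "T = (\<lambda>(i, f::'x \<Rightarrow> 'x, m::nat). left_translations (?K i) (src i \<rightarrow>\<^sub>E carrier G))"
  define p where "p = (\<lambda>(i::nat, f::'x \<Rightarrow> 'x, m::nat) \<rho>::'x \<Rightarrow> 'g. (i, f, \<rho>))"
  define U where "U = (\<lambda>(i, f, m). {(j, g, \<rho>). (j, g, \<rho>) \<in> ?B (box m) \<and> label j g \<le> label i f})"
  define labels where "labels m = (\<lambda>(i, f). label i f) ` Sigma {..<n} (\<lambda>i. src i \<rightarrow>\<^sub>E box m)" for m
  define rank where "rank = (\<lambda>(i, f, m). card {l \<in> labels m. l < label i f})"
  define le where "le = (\<lambda>(i, f, m) (j, g, m'). i = j \<and> (\<exists>h::nat \<Rightarrow> nat. strict_mono h \<and> h ` {..<m} \<subseteq> {..<m'} \<and>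
    (\<forall>a\<in>src i. g a = \<iota> (h (\<kappa> (f a))))))"
  note defs = ob_def coef_def T_def p_def U_def le_def
  have B_iff: "(i, f, \<rho>) \<in> ?B y \<longleftrightarrow> i < n \<and> f \<in> src i \<rightarrow>\<^sub>E y \<and> \<rho> \<in> src i \<rightarrow>\<^sub>E carrier G \<and> inj_on f (src i)"
    for i f \<rho> y by (auto simp: sum_basis_def FI_simps)
  have act: "sum_action (FI G) src y z (g, \<sigma>) (i, f, \<rho>) = (i, compose (src i) g f, \<lambda>a\<in>src i. \<sigma> (f a) \<otimes>\<^bsub>G\<^esub> \<rho> a)"
    for y z g \<sigma> i f \<rho> by (simp add: sum_action_def FI_simps)
  have fin_labels: "finite (labels m)" for m
    unfolding labels_def using src box by (intro finite_imageI finite_SigmaI finite_PiE) auto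
  interpret leading_parts k "Obj (FI G)" ?B ?Mor Q ob le rank U coef T p
  proof (intro leading_parts.intro leading_parts_axioms.intro ring)
    fix y z \<mu> assume yz: "y \<in> Obj (FI G)" "z \<in> Obj (FI G)" and "\<mu> \<in> ?Mor y z"
    then obtain \<phi> where \<phi>: "\<phi> \<in> Hom (FI G) y z" "\<mu> = sum_action (FI G) src y z \<phi>" by blast
    have "inj_on \<mu> (?B y)"
      unfolding \<phi>(2) using FI_monic[OF G(1) \<phi>(1)] by (auto simp: inj_on_def sum_action_def sum_basis_def)
    moreover have "\<mu> ` ?B y \<subseteq> ?B z"
      unfolding \<phi>(2) using category.Comp_in_Hom[OF category_FI[OF G(1)] _ yz _ \<phi>(1)] src
      by (auto simp: sum_action_def sum_basis_def FI_simps(1))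
    ultimately show "inj_on \<mu> (?B y) \<and> \<mu> ` ?B y \<subseteq> ?B z" ..
  next
    fix q assume "q \<in> Q"
    then obtain i f m where q: "q = (i, f, m)" "i < n" "f \<in> src i \<rightarrow>\<^sub>E box m" "inj_on f (src i)" by (auto simp: Q_def)
    show "ob q \<in> Obj (FI G)" using box by (simp add: q defs FI_simps(1))
    show "U q \<subseteq> ?B (ob q)" by (auto simp: q defs)
    show "inj_on (p q) (coef q) \<and> p q ` coef q \<subseteq> ?B (ob q)"
      using q(2-4) by (auto simp: q(1) defs inj_on_def B_iff)
    have K: "group (?K i)" using G(1) by simp
    have KK: "subgroup (src i \<rightarrow>\<^sub>E carrier G) (?K i)" using group.subgroup_self[OF K] by simp
    show "bij_betw \<tau> (coef q) (coef q)" if "\<tau> \<in> T q" for \<tau>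
      using that left_translations_bij[OF K KK] by (simp add: q(1) defs)
    show "\<exists>\<mu>\<in>?Mor (ob q) (ob q). (\<forall>\<rho>\<in>coef q. \<mu> (p q \<rho>) = p q (\<tau> \<rho>)) \<and> \<mu> ` U q \<subseteq> U q" if \<tau>: "\<tau> \<in> T q" for \<tau>
    proof -
      obtain \<gamma> where \<gamma>: "\<gamma> \<in> src i \<rightarrow>\<^sub>E carrier G" "\<tau> = (\<lambda>\<rho>. \<gamma> \<otimes>\<^bsub>?K i\<^esub> \<rho>)"
        using \<tau> by (auto simp: q(1) defs left_translations_def)
      have \<gamma>G: "\<gamma> a \<in> carrier G" if "a \<in> src i" for a using PiE_mem[OF \<gamma>(1) that] .
      \<comment> \<open>The automorphism that fixes the points and multiplies by \<open>\<gamma>\<close>, transported along \<open>f\<close>.\<close>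
      define \<phi> where "\<phi> = (\<lambda>b\<in>box m. b, \<lambda>b\<in>box m. if b \<in> f ` src i then \<gamma> (inv_into (src i) f b) else \<one>\<^bsub>G\<^esub>)"
      let ?\<mu> = "sum_action (FI G) src (box m) (box m) \<phi>"
      have \<phi>: "\<phi> \<in> Hom (FI G) (box m) (box m)"
        using \<gamma>G q(4) by (auto simp: \<phi>_def FI_simps inj_on_def)
      have \<mu>: "?\<mu> (i, f, \<rho>) = (i, f, \<tau> \<rho>)" if "\<rho> \<in> src i \<rightarrow>\<^sub>E carrier G" for \<rho>
      proof -
        have "compose (src i) (\<lambda>b\<in>box m. b) f = f"
          using q(3) by (auto simp: compose_def fun_eq_iff PiE_iff extensional_def)
        moreover have "(\<lambda>a\<in>src i. snd \<phi> (f a) \<otimes>\<^bsub>G\<^esub> \<rho> a) = \<tau> \<rho>"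
          using q(3,4) by (auto simp: \<gamma>(2) \<phi>_def fun_eq_iff PiE_iff)
        ultimately show ?thesis by (simp add: \<phi>_def act)
      qed
      have "?\<mu> b \<in> U q" if b: "b \<in> U q" for b
      proof -
        obtain j g \<rho> where b: "b = (j, g, \<rho>)" "(j, g, \<rho>) \<in> ?B (box m)" "label j g \<le> label i f"
          using b by (auto simp: q(1) defs)
        have "compose (src j) (\<lambda>b\<in>box m. b) g = g"
          using b(2) by (auto simp: B_iff compose_def fun_eq_iff PiE_iff extensional_def)
        moreover have "(\<lambda>a\<in>src j. snd \<phi> (g a) \<otimes>\<^bsub>G\<^esub> \<rho> a) \<in> src j \<rightarrow>\<^sub>E carrier G"
          using b(2) \<gamma>G q(4) by (auto simp: B_iff \<phi>_def PiE_iff)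
        ultimately show ?thesis
          using b by (simp add: \<phi>_def act q(1) defs B_iff)
      qed
      then have "?\<mu> ` U q \<subseteq> U q" by blast
      moreover have "?\<mu> \<in> ?Mor (ob q) (ob q)" using \<phi> by (auto simp: q(1) ob_def)
      moreover have "\<forall>\<rho>\<in>coef q. ?\<mu> (p q \<rho>) = p q (\<tau> \<rho>)" using \<mu> by (simp add: q(1) p_def coef_def)
      ultimately show ?thesis by blast
    qed
    show "U q \<subseteq> p q ` coef q \<or> (\<exists>q'\<in>Q. ob q' = ob q \<and> rank q' < rank q \<and> U q - p q ` coef q \<subseteq> U q')"
    proof (cases "U q \<subseteq> p q ` coef q")
      case False
      let ?D = "U q - p q ` coef q"
      let ?L = "(\<lambda>(j, g, \<rho>). label j g) ` ?D"
      from False have ne: "?L \<noteq> {}" by auto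
      have D: "(j, g, m) \<in> Q \<and> label j g \<in> labels m \<and> label j g < label i f"
        if "(j, g, \<rho>) \<in> ?D" for j g \<rho>
      proof -
        have m: "(j, g, \<rho>) \<in> ?B (box m)" "label j g \<le> label i f" using that by (auto simp: q(1) defs)
        have jg: "j < n" "g \<in> src j \<rightarrow>\<^sub>E box m" "inj_on g (src j)" "\<rho> \<in> src j \<rightarrow>\<^sub>E carrier G" using m(1) by (auto simp: B_iff)
        have "label j g \<noteq> label i f"
        proof
          assume "label j g = label i f"
          then have "j = i" "g = f" using label_inj[OF _ jg(1,2) q(3)] by auto
          then show False using that jg(4) by (auto simp: q(1) defs)
        qed
        then show ?thesis using m(2) jg by (auto simp: Q_def labels_def)
      qed
      then have "?L \<subseteq> labels m" by auto
      then have L: "finite ?L" using fin_labels finite_subset by blast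
      then obtain j g \<rho> where jg: "(j, g, \<rho>) \<in> ?D" "label j g = Max ?L" using Max_in[OF L ne] by auto
      have "label j' g' \<le> label j g" if "(j', g', \<rho>') \<in> ?D" for j' g' \<rho>'
        unfolding jg(2) using that by (intro Max_ge[OF L]) force
      then have "?D \<subseteq> U (j, g, m)" by (auto simp: q(1) defs)
      moreover have "{l \<in> labels m. l < label j g} \<subset> {l \<in> labels m. l < label i f}"
        using D[OF jg(1)] by auto
      then have "rank (j, g, m) < rank q"
        using fin_labels unfolding rank_def q(1) by (auto intro!: psubset_card_mono)
      moreover have "ob (j, g, m) = ob q" by (simp add: q(1) ob_def)
      ultimately show ?thesis using D[OF jg(1)] by blast
    qed simp
    fix q' assume q'Q: "q' \<in> Q" and le: "le q q'"
    obtain f' m' h where q': "q' = (i, f', m')" "f' \<in> src i \<rightarrow>\<^sub>E box m'"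
      "strict_mono h" "h ` {..<m} \<subseteq> {..<m'}" "\<And>a. a \<in> src i \<Longrightarrow> f' a = \<iota> (h (\<kappa> (f a)))"
      using le q'Q by (auto simp: q(1) le_def Q_def)
    define e where "e = (\<lambda>b\<in>box m. \<iota> (h (\<kappa> b)))"
    have e: "e \<in> box m \<rightarrow>\<^sub>E box m'" "inj_on e (box m)"
      using q'(4) \<iota>\<kappa> strict_mono_eq[OF q'(3)] by (auto simp: e_def box_def inj_on_def inj_eq[OF \<iota>])
    define \<phi> where "\<phi> = (e, \<lambda>b\<in>box m. \<one>\<^bsub>G\<^esub>)"
    let ?\<mu> = "sum_action (FI G) src (box m) (box m') \<phi>"
    have \<phi>: "\<phi> \<in> Hom (FI G) (box m) (box m')" using e by (auto simp: \<phi>_def FI_simps)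
    have \<mu>: "?\<mu> (j, g, \<rho>) = (j, compose (src j) e g, \<rho>)"
      if "(j, g, \<rho>) \<in> ?B (box m)" for j g \<rho>
      using that unfolding \<phi>_def act by (auto simp: B_iff PiE_iff fun_eq_iff extensional_def)
    have ef: "compose (src i) e f = f'"
      using q(3) q'(2,5) by (auto simp: compose_def e_def fun_eq_iff PiE_iff extensional_def)
    have U': "(j, compose (src j) e g, \<rho>) \<in> U q'" if b: "(j, g, \<rho>) \<in> U q" for j g \<rho>
    proof -
      have b: "(j, g, \<rho>) \<in> ?B (box m)" "label j g \<le> label i f" using b by (auto simp: q(1) defs)
      have jg: "j < n" "g \<in> src j \<rightarrow>\<^sub>E box m" "inj_on g (src j)" "\<rho> \<in> src j \<rightarrow>\<^sub>E carrier G" using b(1) by (auto simp: B_iff)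
      have "inj_on (compose (src j) e g) (src j)"
        using jg(2,3) e(2) by (auto simp: inj_on_def compose_def PiE_iff)
      then have B: "(j, compose (src j) e g, \<rho>) \<in> ?B (box m')"
        using jg e(1) by (auto simp: B_iff compose_def PiE_iff)
      have "code j (compose (src j) e g) = map h (code j g)"
        using jg(2) xs[OF jg(1)] by (auto simp: code_def compose_def e_def PiE_iff)
      moreover have "code i f' = map h (code i f)"
        using q'(5) xs[OF q(2)] by (auto simp: code_def)
      ultimately have "label j (compose (src j) e g) \<le> label i f'"
        using b(2) map_lexorder_mono[OF q'(3)] by (auto simp: label_def)
      then show ?thesis using B by (simp add: q'(1) defs)
    qed
    have "?\<mu> b \<in> U q'" if "b \<in> U q" for b
    proof -
      obtain j g \<rho> where b: "b = (j, g, \<rho>)" by (metis surj_pair)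
      then have "(j, g, \<rho>) \<in> ?B (box m)" using that by (auto simp: q(1) U_def)
      then show ?thesis using \<mu> U' that b by simp
    qed
    then have "?\<mu> ` U q \<subseteq> U q'" by blast
    moreover have "?\<mu> (p q \<rho>) = p q' \<rho>" if "\<rho> \<in> coef q" for \<rho>
    proof -
      have "(i, f, \<rho>) \<in> ?B (box m)" using that q by (simp add: coef_def B_iff)
      then show ?thesis using \<mu> ef by (simp add: q(1) q'(1) p_def)
    qed
    moreover have "?\<mu> \<in> ?Mor (ob q) (ob q')" using \<phi> by (auto simp: q(1) q'(1) ob_def)
    ultimately have "\<exists>\<mu>\<in>?Mor (ob q) (ob q'). (\<forall>\<rho>\<in>coef q. \<mu> (p q \<rho>) = p q' \<rho>) \<and> \<mu> ` U q \<subseteq> U q'"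
      by blast
    then show "coef q = coef q' \<and> T q = T q' \<and>
        (\<exists>\<mu>\<in>?Mor (ob q) (ob q'). (\<forall>\<rho>\<in>coef q. \<mu> (p q \<rho>) = p q' \<rho>) \<and> \<mu> ` U q \<subseteq> U q')"
      by (simp add: q(1) q'(1) coef_def T_def)
  next
    fix s :: "nat \<Rightarrow> nat \<times> ('x \<Rightarrow> 'x) \<times> nat" assume s: "\<And>j. s j \<in> Q"
    \<comment> \<open>Appending \<open>m\<close> to the list of values makes the increasing map send \<open>m\<close> to \<open>m'\<close>, hence the numbers
      below \<open>m\<close> to numbers below \<open>m'\<close>.\<close>
    define word where "word = (\<lambda>(i, f, m). code i f @ [m])"
    define len where "len = (\<Sum>i<n. Suc (length (xs i)))"
    \<comment> \<open>The first two coordinates force the index \<open>i < n\<close> to be constant. Positions beyond the end of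
      a word give coordinates of unspecified value, which do no harm.\<close>
    define F where "F = {\<lambda>q. fst q, \<lambda>q. n - fst q} \<union> (\<lambda>a q. word q ! a) ` {..<len} \<union>
      (\<lambda>(a, b) q. Suc (word q ! a) - word q ! b) ` ({..<len} \<times> {..<len})"
    have "finite F" by (simp add: F_def)
    from dickson[OF this, of s] obtain r :: "nat \<Rightarrow> nat" where r: "strict_mono r"
      "\<And>c i j. c \<in> F \<Longrightarrow> i \<le> j \<Longrightarrow> c (s (r i)) \<le> c (s (r j))"
      by blast
    have "le (s (r i)) (s (r j))" if ij: "i \<le> j" for i j
    proof -
      obtain a f m where q: "s (r i) = (a, f, m)" "a < n" "f \<in> src a \<rightarrow>\<^sub>E box m"
        using s[of "r i"] by (auto simp: Q_def)
      obtain a' f' m' where q': "s (r j) = (a', f', m')" "a' < n" "f' \<in> src a' \<rightarrow>\<^sub>E box m'"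
        using s[of "r j"] by (auto simp: Q_def)
      have "a \<le> a'" using r(2)[OF _ ij, of "\<lambda>q. fst q"] by (simp add: F_def q q')
      moreover have "n - a \<le> n - a'" using r(2)[OF _ ij, of "\<lambda>q. n - fst q"] by (simp add: F_def q q')
      ultimately have a': "a' = a" using q'(2) by simp
      have wl: "word (s (r i)) = code a f @ [m]" "word (s (r j)) = code a f' @ [m']"
        by (simp_all add: word_def q(1) q'(1) a')
      have "Suc (length (xs a)) \<le> len"
        unfolding len_def using q(2) by (intro member_le_sum[of a "{..<n}" "\<lambda>i. Suc (length (xs i))"]) auto
      then have wlen: "length (word (s (r i))) \<le> len" by (simp add: wl code_def)
      have c1: "word (s (r i)) ! c \<le> word (s (r j)) ! c" if "c < length (word (s (r i)))" for c
        using r(2)[OF _ ij, of "\<lambda>q. word q ! c"] that wlen by (auto simp: F_def)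
      have c2: "Suc (word (s (r i)) ! c) - word (s (r i)) ! d \<le> Suc (word (s (r j)) ! c) - word (s (r j)) ! d"
        if "c < length (word (s (r i)))" "d < length (word (s (r i)))" for c d
        using r(2)[OF _ ij, of "\<lambda>q. Suc (word q ! c) - word q ! d"] that wlen
        by (force simp: F_def)
      obtain h :: "nat \<Rightarrow> nat" where h: "strict_mono h" "map h (word (s (r i))) = word (s (r j))"
        by (rule strict_mono_extension[OF _ c1 c2]) (simp_all add: wl code_def)
      then have hc: "map h (code a f) = code a f'" and hm: "h m = m'" by (simp_all add: wl)
      have "h ` {..<m} \<subseteq> {..<m'}" using strict_monoD[OF h(1)] hm by auto
      moreover have "f' b = \<iota> (h (\<kappa> (f b)))" if b: "b \<in> src a" for b
      proof -
        have "h (\<kappa> (f b)) = \<kappa> (f' b)" using hc b xs[OF q(2)] by (auto simp: code_def)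
        then show ?thesis using \<iota>\<kappa>(1)[OF PiE_mem[OF q'(3)[unfolded a'] b]] by simp
      qed
      ultimately show ?thesis using h(1) by (auto simp: le_def q(1) q'(1) a')
    qed
    then show "\<exists>r::nat \<Rightarrow> nat. strict_mono r \<and> (\<forall>i j. i \<le> j \<longrightarrow> le (s (r i)) (s (r j)))"
      using r(1) by blast
  next
    fix y F assume y: "y \<in> Obj (FI G)" and F: "F \<subseteq> ?B y" "finite F" "F \<noteq> {}"
    define m where "m = card y"
    have "finite y" using y by (simp add: FI_simps(1))
    moreover have "card y = card (box m)" using \<iota> by (simp add: box_def m_def card_image inj_on_subset[OF \<iota>])
    ultimately obtain \<beta> where \<beta>: "bij_betw \<beta> y (box m)" using box finite_same_card_bij by blast
    define \<beta>' where "\<beta>' = inv_into y \<beta>"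
    have \<beta>': "bij_betw \<beta>' (box m) y" unfolding \<beta>'_def by (rule bij_betw_inv_into[OF \<beta>])
    define \<phi> where "\<phi> = (restrict \<beta> y, \<lambda>b\<in>y. \<one>\<^bsub>G\<^esub>)"
    define \<psi> where "\<psi> = (restrict \<beta>' (box m), \<lambda>b\<in>box m. \<one>\<^bsub>G\<^esub>)"
    have \<phi>: "\<phi> \<in> Hom (FI G) y (box m)" and \<psi>: "\<psi> \<in> Hom (FI G) (box m) y"
      using \<beta> \<beta>' by (auto simp: \<phi>_def \<psi>_def FI_simps bij_betw_def)
    let ?\<mu> = "sum_action (FI G) src y (box m) \<phi>" and ?\<nu> = "sum_action (FI G) src (box m) y \<psi>"
    have \<mu>: "?\<mu> (i, f, \<rho>) = (i, compose (src i) \<beta> f, \<rho>)" "?\<mu> (i, f, \<rho>) \<in> ?B (box m)"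
      if "(i, f, \<rho>) \<in> ?B y" for i f \<rho>
    proof -
      show 1: "?\<mu> (i, f, \<rho>) = (i, compose (src i) \<beta> f, \<rho>)"
        using that unfolding \<phi>_def act by (auto simp: B_iff PiE_iff fun_eq_iff extensional_def compose_def)
      show "?\<mu> (i, f, \<rho>) \<in> ?B (box m)"
        unfolding 1 using that \<beta> by (auto simp: B_iff PiE_iff compose_def bij_betw_def inj_on_def)
    qed
    have \<nu>: "?\<nu> (?\<mu> b) = b" if "b \<in> ?B y" for b
    proof -
      obtain i f \<rho> where b: "b = (i, f, \<rho>)" by (metis surj_pair)
      then have B: "(i, f, \<rho>) \<in> ?B y" using that by simp
      have "\<beta>' (\<beta> c) = c" if "c \<in> y" for c unfolding \<beta>'_def using bij_betw_inv_into_left[OF \<beta> that] .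
      moreover have "\<beta> c \<in> box m" if "c \<in> y" for c using \<beta> that by (auto simp: bij_betw_def)
      ultimately show ?thesis
        unfolding b \<mu>(1)[OF B] using B unfolding \<psi>_def act
        by (auto simp: B_iff PiE_iff fun_eq_iff extensional_def compose_def)
    qed
    define F' where "F' = ?\<mu> ` F"
    let ?L = "(\<lambda>(j, g, \<rho>). label j g) ` F'"
    have L: "finite ?L" "?L \<noteq> {}" using F by (auto simp: F'_def)
    obtain j g \<rho> where jg: "(j, g, \<rho>) \<in> F'" "label j g = Max ?L" using Max_in[OF L] by auto
    have sub: "F' \<subseteq> ?B (box m)" using \<mu>(2) F(1) unfolding F'_def by auto
    have "label j' g' \<le> label j g" if "(j', g', \<rho>') \<in> F'" for j' g' \<rho>'
      unfolding jg(2) using that by (intro Max_ge[OF L(1)]) force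
    then have "?\<mu> ` F \<subseteq> U (j, g, m)" using sub unfolding F'_def[symmetric] by (auto simp: U_def)
    moreover have "(j, g, m) \<in> Q" using subsetD[OF sub jg(1)] by (simp add: Q_def B_iff)
    ultimately show "\<exists>q\<in>Q. \<exists>\<mu>\<in>?Mor y (ob q). \<exists>\<nu>\<in>?Mor (ob q) y. \<mu> ` F \<subseteq> U q \<and> (\<forall>b\<in>?B y. \<nu> (\<mu> b) = b)"
      using \<phi> \<psi> \<nu> unfolding ob_def by (intro bexI[of _ "(j, g, m)"]) (simp, blast)
  qed
  show ?thesis
  proof (rule noetherian_if_coefficients_noetherian)
    fix q assume "q \<in> Q"
    then obtain i f m where q: "q = (i, f, m)" "i < n" by (auto simp: Q_def)
    show "noetherian_set k (coef q) (T q)"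
      using noetherian_power_polycyclic_by_finite[OF G k src[OF q(2)]] by (simp add: q(1) coef_def T_def)
  qed
qed

theorem corollary1p2p2:
  fixes G :: "('g, 'b) monoid_scheme" and k :: "('r, 'c) ring_scheme"
  assumes "group G" and "polycyclic_by_finite G"
    and "ring k" and "\<one>\<^bsub>k\<^esub> \<noteq> \<zero>\<^bsub>k\<^esub>" and "left_noetherian k"
  shows "Rep_noetherian (FI G :: ('x::infinite set, ('x \<Rightarrow> 'x) \<times> ('x \<Rightarrow> 'g)) category) k
           TYPE('v)"
proof (rule Rep_noetherian_if_noetherian_diagrams)
  show "category (FI G :: ('x set, ('x \<Rightarrow> 'x) \<times> ('x \<Rightarrow> 'g)) category)" by (rule category_FI[OF assms(1)])
  show "ring k" by fact
  show "inj_on (Comp (FI G) x y z \<phi>) (Hom (FI G) x y)"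
    if "\<phi> \<in> Hom (FI G) y z" for x y z :: "'x set" and \<phi>
    by (rule FI_monic[OF assms(1) that])
  show "noetherian_diagram k (Obj (FI G)) (sum_basis (FI G) n src)
      (\<lambda>y z. sum_action (FI G) src y z ` Hom (FI G) y z)"
    if "\<And>i. i < n \<Longrightarrow> src i \<in> Obj (FI G)" for n and src :: "nat \<Rightarrow> 'x set"
    using that by (intro noetherian_FI_diagram assms) (simp add: FI_simps(1))
qed

end
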